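(* The Ramanujan-de Bruijn function $X(z)=(2\pi)^{-(6+z)}\Gamma(6+z)H_\tau(6+z)$, $z\in\mathbb{C}$, is an even entire function of order $\lambda=1$.
   Context: The Ramanujan function $\tau(m)$ is defined by $q\prod_{n=1}^\infty(1-q^n)^{24}=\sum_{m=1}^\infty\tau(m)q^m$. The Ramanujan zeta function is $H_\tau(x)=\sum_{\ell=1}^\infty \tau(\ell)\ell^{-x}$ for $\Re(x)>13/2$, and $H_\tau$ also denotes its analytic continuation to $\mathbb{C}$. The Ramanujan-Rankin function $\xi_\tau(x)=(2\pi)^{-x}\Gamma(x)H_\tau(x)$ is understood as extended to $\mathbb{C}$ (removing removable singularities), and $X(z)=\xi_\tau(6+z)$. The order of an entire function $f$ is its order of growth $\limsup_{r\to\infty}\frac{\ln\ln\max_{|z|=r}|f(z)|}{\ln r}$. *)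

theory Defs
  imports "HOL-Complex_Analysis.Complex_Analysis" "HOL-Computational_Algebra.Formal_Power_Series"
begin

(* The generating identity is read in int[[q]], where the infinite product converges
   in the q-adic metric; prodinf indexes its factors from n = 0. *)
definition ramanujan_tau :: "nat \<Rightarrow> int" where
  "ramanujan_tau m =
     fps_nth (fps_X * prodinf (\<lambda>n. (1 - fps_X ^ Suc n) ^ 24 :: int fps)) m"

definition ramanujan_zeta :: "complex \<Rightarrow> complex" where
  "ramanujan_zeta =
     (THE H. H holomorphic_on UNIV \<and>
        (\<forall>x. Re x > 13 / 2 \<longrightarrow>
           (\<lambda>k. of_int (ramanujan_tau (Suc k)) * of_nat (Suc k) powr (- x)) sums H x))"

(* Gamma takes the value 0 at its poles 0, -1, -2, ...; remove_sings replaces the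
   values there by the limits. *)
definition ramanujan_rankin_xi :: "complex \<Rightarrow> complex" where
  "ramanujan_rankin_xi =
     remove_sings (\<lambda>x. of_real (2 * pi) powr (- x) * Gamma x * ramanujan_zeta x)"

definition ramanujan_de_bruijn :: "complex \<Rightarrow> complex" where
  "ramanujan_de_bruijn z = ramanujan_rankin_xi (6 + z)"

(* Intended for entire f, where the supremum over the circle is the attained maximum.
   If f is not constant, that maximum exceeds 1 for large r, so both logarithms are
   eventually genuine. *)
definition growth_order :: "(complex \<Rightarrow> complex) \<Rightarrow> ereal" where
  "growth_order f =
     Limsup at_top (\<lambda>r::real. ereal (ln (ln (SUP z\<in>sphere 0 r. norm (f z))) / ln r))"

end

theory Submission
  imports Defs "HOL-Real_Asymp.Real_Asymp"
begin

text \<open>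
  Write \<open>\<Delta>(z) = \<Sum>m. \<tau>(m) q^m = q \<Prod>n. (1 - q^n)^24\<close> with \<open>q = exp (2 \<pi> i z)\<close>, and
  \<open>\<Phi>(t) = exp (6 t) \<Delta>(i exp t)\<close>. Termwise Mellin transformation gives \<open>X(z) = \<integral> \<Phi>(t) exp (z t) dt\<close>
  over the real line. The modular relation \<open>\<Delta>(-1/z) = z^12 \<Delta>(z)\<close> says that \<open>\<Phi>\<close> is even, hence so is
  \<open>X\<close>; doubly exponential decay of \<open>\<Phi>\<close> makes \<open>X\<close> entire; and \<open>\<Phi> > 0\<close> together with
  \<open>r \<bar>t\<bar> - exp \<bar>t\<bar> \<le> r ln r\<close> traps the maximum of \<open>\<bar>X\<bar>\<close> on the circle of radius \<open>r\<close> between constant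
  multiples of \<open>exp (2 r)\<close> and \<open>exp (r ln r)\<close>.

  The modular relation is proved at \<open>z = i y\<close> with \<open>y = p/q\<close> rational and extended by the identity theorem.
  There \<open>ln \<Delta>\<close> is a Lambert series in \<open>1 / (exp (2 \<pi> m y) - 1)\<close>, which the partial fractions of \<open>coth\<close> turn
  into a double sum of \<open>y / (m\<^sup>2 y\<^sup>2 + k\<^sup>2)\<close>, symmetric under exchanging \<open>m, k\<close> and inverting \<open>y\<close>.
  Cutting it at \<open>m \<le> q n\<close>, \<open>k \<le> p n\<close> leaves two tails, both close to Riemann sums for the integral of
  \<open>arctan s / s\<close> over \<open>[0, 1]\<close>, which cancel in the limit; the harmonic numbers contribute \<open>ln y\<close>.

  Absolute convergence of the Dirichlet series for \<open>Re s > 13/2\<close> needs no bound on individual \<open>\<tau>(n)\<close>: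
  \<open>(Im z)^6 \<bar>\<Delta>(z)\<bar>\<close> is bounded, so Parseval gives \<open>\<Sum>n\<le>N. \<tau>(n)\<^sup>2 = O(N^12)\<close>.
\<close>

section \<open>The Lambert series of the logarithm of the discriminant\<close>

text \<open>Logarithmic differentiation of the reflection formula for \<open>Gamma\<close> expresses
  \<open>Digamma z - Digamma (1 - z)\<close> by the cotangent, and the series of
  \<open>Digamma\<close> turns that into partial fractions. At \<open>z = i x\<close> the cotangent
  becomes hyperbolic: the right-hand side is \<open>pi / 2\<close> times \<open>coth (pi x)\<close>,
  minus the pole term.\<close>

lemma coth_partial_fractions:
  fixes x :: real
  assumes x: "x > 0"
  shows "(\<lambda>k. x / (x\<^sup>2 + (real (Suc k))\<^sup>2)) sums (pi * (1 / (exp (2 * pi * x) - 1) + 1 / 2) - 1 / (2 * x))"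
proof -
  define z where "z = \<i> * of_real x"
  have z: "z \<notin> \<int>" "- z \<notin> \<int>" "1 - z \<notin> \<int>" "z \<noteq> 0"
    using x by (auto simp: z_def complex_is_Int_iff)
  have ni: "z \<notin> \<int>\<^sub>\<le>\<^sub>0" "1 - z \<notin> \<int>\<^sub>\<le>\<^sub>0" "-z \<notin> \<int>\<^sub>\<le>\<^sub>0"
    using z by auto
  have Gnz: "Gamma z \<noteq> 0" "Gamma (1 - z) \<noteq> 0"
    using ni by (auto simp: Gamma_eq_zero_iff)
  have sin_nz: "sin (of_real pi * z) \<noteq> 0"
    using z(1) by (simp add: sin_eq_0 mult.commute) (metis Ints_of_int)
  have ev: "eventually (\<lambda>w. Gamma w * Gamma (1 - w) * sin (of_real pi * w) = of_real pi) (nhds z)"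
  proof -
    have "open (- \<int> :: complex set)" by (simp add: open_Compl closed_Ints)
    hence "eventually (\<lambda>w. w \<in> - \<int>) (nhds z)" using z by (intro eventually_nhds_in_open) auto
    thus ?thesis
    proof eventually_elim
      case (elim w)
      have "sin (of_real pi * w) \<noteq> 0"
        using elim by (simp add: sin_eq_0 mult.commute) (metis Ints_of_int)
      thus ?case by (simp add: Gamma_reflection_complex)
    qed
  qed
  \<comment> \<open>The product is locally constant, so this derivative vanishes; cancelling the
    nonzero Gamma factors leaves the cotangent identity.\<close>
  have D: "((\<lambda>w. Gamma w * Gamma (1 - w) * sin (of_real pi * w)) has_field_derivative
      (Gamma z * Gamma (1 - z) * ((Digamma z - Digamma (1 - z)) * sin (of_real pi * z) + of_real pi * cos (of_real pi * z)))) (at z)"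
    by (rule derivative_eq_intros refl | use ni in \<open>simp add: algebra_simps\<close>)+
  have "((\<lambda>w. Gamma w * Gamma (1 - w) * sin (of_real pi * w)) has_field_derivative 0) (at z)"
    using DERIV_cong_ev[OF refl ev refl] by simp
  from DERIV_unique[OF D this] have "(Digamma z - Digamma (1 - z)) * sin (of_real pi * z) + of_real pi * cos (of_real pi * z) = 0"
    using Gnz by simp
  hence eq1: "Digamma z - Digamma (1 - z) = - of_real pi * cos (of_real pi * z) / sin (of_real pi * z)"
    using sin_nz by (simp add: field_simps add_eq_0_iff)
  have eq2: "Digamma (1 - z) = Digamma (- z) - 1 / z"
    using Digamma_plus1[of "-z"] z by simp
  have s1: "(\<lambda>n. inverse (of_nat (Suc n)) - inverse (w + of_nat n)) sums (Digamma w + euler_mascheroni)" if "w \<noteq> 0" for w :: complex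
    using summable_Digamma[OF that] by (simp add: Digamma_def summable_sums)
  have "(\<lambda>n. (inverse (of_nat (Suc n)) - inverse (z + of_nat n)) - (inverse (of_nat (Suc n)) - inverse (- z + of_nat n)))
     sums ((Digamma z + euler_mascheroni) - (Digamma (- z) + euler_mascheroni))"
    by (intro sums_diff s1) (use z in auto)
  hence "(\<lambda>n. inverse (- z + of_nat n) - inverse (z + of_nat n)) sums (Digamma z - Digamma (- z))"
    by simp
  \<comment> \<open>The dropped term at \<open>n = 0\<close> is \<open>- 2 / z\<close>.\<close>
  hence "(\<lambda>n. inverse (- z + of_nat (Suc n)) - inverse (z + of_nat (Suc n))) sums (Digamma z - Digamma (- z) + 2 / z)"
    using z unfolding sums_Suc_iff[of "\<lambda>n. inverse (- z + of_nat n) - inverse (z + of_nat n)"]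
    by (simp add: inverse_eq_divide algebra_simps)
  also have "Digamma z - Digamma (- z) + 2 / z = 1 / z - of_real pi * cos (of_real pi * z) / sin (of_real pi * z)"
  proof -
    have "Digamma z - Digamma (- z) + 2 / z = (Digamma z - Digamma (1 - z)) + 1 / z"
      unfolding eq2 by simp
    thus ?thesis unfolding eq1 by simp
  qed
  finally have S: "(\<lambda>n. inverse (- z + of_nat (Suc n)) - inverse (z + of_nat (Suc n))) sums (1 / z - of_real pi * cos (of_real pi * z) / sin (of_real pi * z))" .
  have trm: "inverse (- z + of_nat (Suc n)) - inverse (z + of_nat (Suc n)) = 2 * \<i> * of_real (x / (x\<^sup>2 + (real (Suc n))\<^sup>2))" for n
  proof -
    define N :: complex where "N = of_nat (Suc n)"
    have nz: "- z + N \<noteq> 0" "z + N \<noteq> 0"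
      using x by (auto simp: z_def complex_eq_iff N_def)
    have "inverse (- z + N) - inverse (z + N) = ((z + N) - (- z + N)) / ((- z + N) * (z + N))"
      using nz by (simp add: inverse_eq_divide diff_frac_eq)
    also have "\<dots> = 2 * z / (N\<^sup>2 - z\<^sup>2)"
      by (simp add: power2_eq_square algebra_simps)
    finally have "inverse (- z + of_nat (Suc n)) - inverse (z + of_nat (Suc n)) = 2 * z / ((of_nat (Suc n))\<^sup>2 - z\<^sup>2)"
      by (simp add: N_def)
    also have "z\<^sup>2 = - of_real (x\<^sup>2)" by (simp add: z_def power_mult_distrib)
    finally show ?thesis by (simp add: z_def add.commute)
  qed
  have ex: "of_real pi * cos (of_real pi * z) / sin (of_real pi * z) = - \<i> * of_real (pi * (1 + 2 / (exp (2 * pi * x) - 1)))"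
  proof -
    define e where "e = exp (pi * x)"
    have e: "e > 1" using x by (simp add: e_def)
    have e2: "exp (2 * pi * x) = e\<^sup>2" by (simp add: e_def mult.assoc flip: exp_double)
    have w: "\<i> * (of_real pi * z) = - of_real (pi * x)" by (simp add: z_def complex_eq_iff)
    have E: "exp (\<i> * (of_real pi * z)) = of_real (inverse e)" "exp (- (\<i> * (of_real pi * z))) = of_real e"
      unfolding w e_def by (simp_all add: exp_of_real exp_minus flip: of_real_mult of_real_minus)
    define s d where "s = inverse e + e" and "d = inverse e - e"
    have cs: "cos (of_real pi * z) = of_real s / 2" "sin (of_real pi * z) = of_real d / (2 * \<i>)"
      unfolding cos_exp_eq sin_exp_eq E s_def d_def by simp_all
    have "of_real pi * cos (of_real pi * z) / sin (of_real pi * z) = \<i> * of_real (pi * (s / d))"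
      unfolding cs by (cases "d = 0") (simp_all add: field_simps)
    also have "s / d = - ((e + inverse e) / (e - inverse e))"
      by (simp add: s_def d_def add.commute flip: divide_minus_right)
    also have "\<i> * of_real (pi * - ((e + inverse e) / (e - inverse e))) = - \<i> * of_real (pi * ((e + inverse e) / (e - inverse e)))"
      by simp
    also have "(e + inverse e) / (e - inverse e) = 1 + 2 / (e\<^sup>2 - 1)"
    proof -
      have "(e + inverse e) / (e - inverse e) = (e * (e + inverse e)) / (e * (e - inverse e))"
        using e by simp
      also have "\<dots> = (e\<^sup>2 + 1) / (e\<^sup>2 - 1)"
        using e by (simp add: algebra_simps power2_eq_square)
      also have "\<dots> = 1 + 2 / (e\<^sup>2 - 1)"
        using one_less_power[OF e, of 2] by (simp add: divide_simps)
      finally show ?thesis .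
    qed
    finally show ?thesis by (simp add: e2)
  qed
  have calc: "(\<lambda>n. Im (2 * \<i> * of_real (x / (x\<^sup>2 + (real (Suc n))\<^sup>2)))) sums Im (1 / z - of_real pi * cos (of_real pi * z) / sin (of_real pi * z))"
    using sums_Im[OF S] unfolding trm .
  have "(\<lambda>n. 2 * (x / (x\<^sup>2 + (real (Suc n))\<^sup>2))) sums (- 1 / x + pi * (1 + 2 / (exp (2 * pi * x) - 1)))"
  proof -
    have im: "Im (1 / z - - \<i> * of_real A) = - 1 / x + A" for A
      using x by (simp add: z_def Im_divide power2_eq_square)
    have re: "Im (2 * \<i> * of_real B) = 2 * B" for B by simp
    show ?thesis using calc by (simp only: ex im re)
  qed
  hence "(\<lambda>n. 2 * (x / (x\<^sup>2 + (real (Suc n))\<^sup>2)) / 2) sums ((- 1 / x + pi * (1 + 2 / (exp (2 * pi * x) - 1))) / 2)"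
    by (rule sums_divide)
  also have "(- 1 / x + pi * (1 + 2 / (exp (2 * pi * x) - 1))) / 2 = pi * (1 / (exp (2 * pi * x) - 1) + 1 / 2) - 1 / (2 * x)"
    using mult_divide_mult_cancel_left[of 2 pi "exp (2 * pi * x) - 1"]
    by (simp add: algebra_simps add_divide_distrib diff_divide_distrib del: mult_divide_mult_cancel_left_if)
  finally show ?thesis unfolding nonzero_mult_div_cancel_left[OF zero_neq_numeral[symmetric]] .
qed

section \<open>Riemann sums and arctangent estimates for the tails\<close>

text \<open>Increments of the antiderivative telescope to the integral; on each cell the mean value
  theorem replaces the increment by a value of \<open>h\<close>, which uniform continuity moves to
  the right endpoint.\<close>

lemma riemann_sum_tendsto_integral:
  fixes h :: "real \<Rightarrow> real"
  assumes h: "continuous_on {0..1} h"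
  shows "(\<lambda>M. \<Sum>m=1..M. h (real m / real M) / real M) \<longlonglongrightarrow> integral {0..1} h"
proof -
  define H where "H x = integral {0..x} h" for x
  have dH: "(H has_real_derivative h x) (at x within {0..1})" if "x \<in> {0..1}" for x
    unfolding H_def using integral_has_real_derivative[OF h that] .
  show ?thesis
  proof (rule LIMSEQ_I)
    fix e :: real assume e: "e > 0"
    have "uniformly_continuous_on {0..1} h" using h by (intro compact_uniformly_continuous) auto
    then obtain d where d: "d > 0" "\<And>x x'. x \<in> {0..1} \<Longrightarrow> x' \<in> {0..1} \<Longrightarrow> dist x' x < d \<Longrightarrow> dist (h x') (h x) < e / 2"
      unfolding uniformly_continuous_on_def using e by (metis half_gt_zero)
    obtain N where N: "N > 0" "inverse (real N) < d" using d(1) ex_inverse_of_nat_less by blast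
    have "norm ((\<Sum>m=1..M. h (real m / real M) / real M) - integral {0..1} h) < e" if M: "M \<ge> N" for M
    proof -
      have M0: "M > 0" using M N by simp
      have step: "\<bar>h (real m / real M) / real M - (H (real m / real M) - H (real (m - 1) / real M))\<bar> \<le> e / 2 / real M"
        if m: "m \<in> {1..M}" for m
      proof -
        let ?a = "real (m-1) / real M" and ?b = "real m / real M"
        have ab: "?a < ?b" "0 \<le> ?a" "?b \<le> 1" using m M0 by (auto simp: field_simps)
        have len: "?b - ?a = 1 / real M" using m M0 by (simp add: field_simps of_nat_diff)
        have "\<exists>\<xi>. ?a < \<xi> \<and> \<xi> < ?b \<and> H ?b - H ?a = (?b - ?a) * h \<xi>"
        proof -
          have "(H has_derivative (*) (h x)) (at x within {?a..?b})" if "?a \<le> x" "x \<le> ?b" for x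
            using DERIV_subset[OF dH[of x], of "{?a..?b}"] order_trans[OF ab(2) that(1)] order_trans[OF that(2) ab(3)] ab
            by (auto simp: has_field_derivative_def)
          from mvt_simple[OF ab(1) this] show ?thesis by (auto simp: mult.commute)
        qed
        then obtain \<xi> where xi: "?a < \<xi>" "\<xi> < ?b" "H ?b - H ?a = (?b - ?a) * h \<xi>" by blast
        have "dist ?b \<xi> < d"
        proof -
          have "dist ?b \<xi> < 1 / real M" using xi len by (simp add: dist_real_def)
          also have "1 / real M \<le> inverse (real N)" using M N by (simp add: field_simps)
          finally show ?thesis using N by linarith
        qed
        hence "dist (h ?b) (h \<xi>) < e / 2" using xi order_trans[OF ab(2) less_imp_le[OF xi(1)]] ab by (intro d(2)) auto
        hence "\<bar>(h ?b - h \<xi>) / real M\<bar> \<le> e / 2 / real M"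
          unfolding abs_divide using M0 by (intro divide_right_mono frac_le) (use e in \<open>auto simp: dist_real_def\<close>)
        thus ?thesis using xi(3) len by (simp add: diff_divide_distrib)
      qed
      have tel: "(\<Sum>m=1..M. H (real m / real M) - H (real (m - 1) / real M)) = integral {0..1} h"
      proof -
        have "(\<Sum>m=1..n. H (real m / real M) - H (real (m - 1) / real M)) = H (real n / real M) - H 0" for n
          by (induction n) auto
        thus ?thesis using M0 by (simp add: H_def)
      qed
      have "norm ((\<Sum>m=1..M. h (real m / real M) / real M) - integral {0..1} h)
        = \<bar>\<Sum>m=1..M. h (real m / real M) / real M - (H (real m / real M) - H (real (m - 1) / real M))\<bar>"
        by (simp add: tel[symmetric] sum_subtractf)
      also have "\<dots> \<le> (\<Sum>m=1..M. e / 2 / real M)"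
        by (rule order_trans[OF sum_abs sum_mono]) (rule step)
      also have "\<dots> = e / 2" using M0 by simp
      finally show ?thesis using e by simp
    qed
    thus "\<exists>N. \<forall>M\<ge>N. norm ((\<Sum>m=1..M. h (real m / real M) / real M) - integral {0..1} h) < e" by blast
  qed
qed

text \<open>A Riemann sum for \<open>arctan s / s\<close>, continued by 1 at 0. The value of the
  limit is immaterial: the inversion formula contains it twice with opposite signs.\<close>

lemma arctan_sum_convergent: "\<exists>G. (\<lambda>M. \<Sum>m=1..M. arctan (real m / real M) / real m) \<longlonglongrightarrow> G"
proof -
  define h where "h s = (if s = 0 then 1 else arctan s / s)" for s :: real
  have "isCont h s" for s
  proof (cases "s = 0")
    case True
    have "(arctan has_real_derivative inverse (1 + 0\<^sup>2)) (at 0)" by (rule DERIV_arctan)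
    hence "((\<lambda>s. arctan s / s) \<longlongrightarrow> 1) (at 0)" by (simp add: has_field_derivative_iff)
    hence "(h \<longlongrightarrow> 1) (at 0)"
      by (rule Lim_transform_eventually) (auto simp: h_def eventually_at_filter)
    thus ?thesis using True by (simp add: isCont_def h_def)
  next
    case False
    hence "eventually (\<lambda>w. h w = arctan w / w) (nhds s)"
      by (intro eventually_mono[OF t1_space_nhds[of s 0]]) (auto simp: h_def)
    moreover have "isCont (\<lambda>w. arctan w / w) s" using False by (intro continuous_intros)
    ultimately show ?thesis by (subst isCont_cong)
  qed
  hence "continuous_on {0..1} h" by (simp add: continuous_at_imp_continuous_on)
  from riemann_sum_tendsto_integral[OF this]
  have "(\<lambda>M. \<Sum>m=1..M. h (real m / real M) / real M) \<longlonglongrightarrow> integral {0..1} h" .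
  moreover have "(\<Sum>m=1..M. h (real m / real M) / real M) = (\<Sum>m=1..M. arctan (real m / real M) / real m)" for M
    by (rule sum.cong) (auto simp: h_def)
  ultimately show ?thesis by auto
qed

text \<open>An integral test: \<open>- arctan (c / t)\<close> is an antiderivative of the decreasing
  function \<open>c / (c^2 + t^2)\<close>, so each term is squeezed between neighbouring increments,
  and these telescope.\<close>

lemma arctan_tail_bounds:
  fixes c :: real and K :: nat
  assumes c: "c > 0" and K: "K > 0"
  shows "summable (\<lambda>j. c / (c\<^sup>2 + (real (K + Suc j))\<^sup>2))"
    and "(\<Sum>j. c / (c\<^sup>2 + (real (K + Suc j))\<^sup>2)) \<le> arctan (c / real K)"
    and "arctan (c / real (Suc K)) \<le> (\<Sum>j. c / (c\<^sup>2 + (real (K + Suc j))\<^sup>2))"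
proof -
  have step: "c / (c\<^sup>2 + (real (Suc k))\<^sup>2) \<le> arctan (c / real k) - arctan (c / real (Suc k)) \<and>
      arctan (c / real k) - arctan (c / real (Suc k)) \<le> c / (c\<^sup>2 + (real k)\<^sup>2)" if k: "k > 0" for k
  proof -
    have "((\<lambda>t. - arctan (c / t)) has_real_derivative c / (c\<^sup>2 + t\<^sup>2)) (at t)" if "t > 0" for t
    proof -
      have "((\<lambda>t. - arctan (c / t)) has_real_derivative - (inverse (1 + (c / t)\<^sup>2) * (- (c / t\<^sup>2)))) (at t)"
        by (rule derivative_eq_intros refl | use that in \<open>simp add: power2_eq_square\<close>)+
      also have "- (inverse (1 + (c / t)\<^sup>2) * (- (c / t\<^sup>2))) = c / ((1 + (c / t)\<^sup>2) * t\<^sup>2)"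
        by (simp add: divide_inverse mult_ac)
      also have "(1 + (c / t)\<^sup>2) * t\<^sup>2 = c\<^sup>2 + t\<^sup>2"
        using that by (simp add: algebra_simps power_divide)
      finally show ?thesis .
    qed
    hence "\<exists>t. real k < t \<and> t < real (Suc k) \<and>
        (- arctan (c / real (Suc k))) - (- arctan (c / real k)) = (real (Suc k) - real k) * (c / (c\<^sup>2 + t\<^sup>2))"
      using k by (intro MVT2) auto
    then obtain t where t: "real k < t" "t < real (Suc k)" "arctan (c / real k) - arctan (c / real (Suc k)) = c / (c\<^sup>2 + t\<^sup>2)"
      by auto
    have "(real k)\<^sup>2 \<le> t\<^sup>2" "t\<^sup>2 \<le> (real (Suc k))\<^sup>2" using t k by (auto intro!: power_mono)
    thus ?thesis unfolding t(3) using c k t(1)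
      by (intro conjI divide_left_mono) (auto intro!: mult_pos_pos add_pos_pos)
  qed
  have lim: "(\<lambda>j. arctan (c / real (N + j))) \<longlonglongrightarrow> 0" for N
  proof -
    have "(\<lambda>j. arctan (c / real (j + N))) \<longlonglongrightarrow> arctan 0"
      by (rule tendsto_arctan, rule LIMSEQ_ignore_initial_segment[of "\<lambda>j. c / real j"], rule lim_const_over_n)
    thus ?thesis by (simp add: add.commute)
  qed
  have tel: "(\<lambda>j. arctan (c / real (N + j)) - arctan (c / real (N + Suc j))) sums arctan (c / real N)" for N
    using telescope_sums'[OF lim[of N]] by simp
  have s1: "summable (\<lambda>j. arctan (c / real (K + j)) - arctan (c / real (K + Suc j)))"
    and s2: "summable (\<lambda>j. arctan (c / real (Suc K + j)) - arctan (c / real (Suc K + Suc j)))"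
    using tel sums_summable by blast+
  show sm: "summable (\<lambda>j. c / (c\<^sup>2 + (real (K + Suc j))\<^sup>2))"
    by (rule summable_comparison_test'[OF s1, of 0]) (use step[of "K + n" for n] K c in auto)
  have "(\<Sum>j. c / (c\<^sup>2 + (real (K + Suc j))\<^sup>2)) \<le> (\<Sum>j. arctan (c / real (K + j)) - arctan (c / real (K + Suc j)))"
    by (rule suminf_le[OF _ sm s1]) (use step[of "K + n" for n] K in auto)
  also have "\<dots> = arctan (c / real K)" using tel sums_unique by metis
  finally show "(\<Sum>j. c / (c\<^sup>2 + (real (K + Suc j))\<^sup>2)) \<le> arctan (c / real K)" .
  have "arctan (c / real (Suc K)) = (\<Sum>j. arctan (c / real (Suc K + j)) - arctan (c / real (Suc K + Suc j)))"
    using tel sums_unique by metis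
  also have "\<dots> \<le> (\<Sum>j. c / (c\<^sup>2 + (real (K + Suc j))\<^sup>2))"
    by (rule suminf_le[OF _ s2 sm]) (use step[of "Suc K + n" for n] K in auto)
  finally show "arctan (c / real (Suc K)) \<le> (\<Sum>j. c / (c\<^sup>2 + (real (K + Suc j))\<^sup>2))" .
qed

text \<open>The choice of \<open>y\<close> turns the upper tail bound
  \<open>arctan (m y / K)\<close> into exactly \<open>arctan (m / M)\<close>. As arctan is
  1-Lipschitz, the lower bound is smaller by at most \<open>m / (M K)\<close>; after division by
  \<open>m\<close>, the \<open>M\<close> errors add up to \<open>1 / K\<close>.\<close>

lemma weighted_arctan_tail_bound:
  fixes M K :: nat
  assumes M: "M > 0" and K: "K > 0"
  defines "y \<equiv> real K / real M"
  shows "\<bar>(\<Sum>m=1..M. (\<Sum>j. (real m * y) / ((real m * y)\<^sup>2 + (real (K + Suc j))\<^sup>2)) / real m)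
            - (\<Sum>m=1..M. arctan (real m / real M) / real m)\<bar> \<le> 1 / real K"
proof -
  have y: "y > 0" using M K by (simp add: y_def)
  define t where "t m = (\<Sum>j. (real m * y) / ((real m * y)\<^sup>2 + (real (K + Suc j))\<^sup>2))" for m
  have b: "arctan (real m / real M) / real m - 1 / (real M * real K) \<le> t m / real m
      \<and> t m / real m \<le> arctan (real m / real M) / real m" if m: "m \<in> {1..M}" for m
  proof -
    have c: "real m * y > 0" using m y by simp
    have u: "real m * y / real K = real m / real M" using K M by (simp add: y_def)
    have v: "real m * y / real (Suc K) \<le> real m / real M"
      unfolding u[symmetric] using c K by (intro divide_left_mono) auto
    have d: "arctan (real m / real M) - arctan (real m * y / real (Suc K)) \<le> real m / real M - real m * y / real (Suc K)"
    proof -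
      have "\<exists>z. arctan (real m / real M) - arctan (real m * y / real (Suc K)) = (real m / real M - real m * y / real (Suc K)) * inverse (1 + z\<^sup>2)"
      proof (cases "real m * y / real (Suc K) = real m / real M")
        case False
        with v have "real m * y / real (Suc K) < real m / real M" by simp
        from MVT2[OF this DERIV_arctan] show ?thesis by blast
      qed auto
      then obtain z where z: "arctan (real m / real M) - arctan (real m * y / real (Suc K)) = (real m / real M - real m * y / real (Suc K)) * inverse (1 + z\<^sup>2)" ..
      have "inverse (1 + z\<^sup>2) \<le> 1" by (intro inverse_le_1_iff[THEN iffD2]) auto
      thus ?thesis unfolding z using v by (intro mult_left_le) auto
    qed
    have "real m / real M - real m * y / real (Suc K) = real m * y * (1 / real K - 1 / real (Suc K))"
      unfolding u[symmetric] by (simp add: right_diff_distrib)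
    also have "1 / real K - 1 / real (Suc K) = 1 / (real K * real (Suc K))"
      using K by (simp add: divide_simps)
    also have "\<dots> \<le> 1 / (real K * real K)"
      using K by (intro divide_left_mono) auto
    also have "real m * y * (1 / (real K * real K)) = real m * (1 / (real M * real K))"
      using K by (simp add: y_def)
    finally have d2: "real m / real M - real m * y / real (Suc K) \<le> real m * (1 / (real M * real K))"
      using c by (simp add: mult_left_mono)
    have t: "t m \<le> arctan (real m / real M)" "arctan (real m * y / real (Suc K)) \<le> t m"
      using arctan_tail_bounds(2,3)[OF c K] unfolding u t_def by auto
    have "arctan (real m / real M) - real m * (1 / (real M * real K)) \<le> t m"
      using d d2 t by linarith
    hence "(arctan (real m / real M) - real m * (1 / (real M * real K))) / real m \<le> t m / real m"
      by (rule divide_right_mono) simp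
    moreover have "(arctan (real m / real M) - real m * (1 / (real M * real K))) / real m = arctan (real m / real M) / real m - 1 / (real M * real K)"
      using m by (simp add: diff_divide_distrib)
    ultimately show ?thesis using t(1) by (auto intro: divide_right_mono)
  qed
  have "(\<Sum>m=1..M. arctan (real m / real M) / real m - 1 / (real M * real K)) \<le> (\<Sum>m=1..M. t m / real m)"
       "(\<Sum>m=1..M. t m / real m) \<le> (\<Sum>m=1..M. arctan (real m / real M) / real m)"
    by (intro sum_mono; use b in blast)+
  moreover have "(\<Sum>m=1..M. arctan (real m / real M) / real m - 1 / (real M * real K))
     = (\<Sum>m=1..M. arctan (real m / real M) / real m) - 1 / real K"
    using M by (simp add: sum_subtractf)
  ultimately show ?thesis unfolding t_def by linarith
qed

section \<open>Lambert sums and their inversion formula\<close>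

text \<open>Partial sums of the Lambert series for minus the logarithm of the product of all
  \<open>1 - q ^ n\<close>, \<open>n \<ge> 1\<close>, at \<open>q = exp (- 2 pi y)\<close>.\<close>

definition lambert_sum :: "real \<Rightarrow> nat \<Rightarrow> real" where
  "lambert_sum y M = (\<Sum>m=1..M. 1 / real m / (exp (2 * pi * (real m * y)) - 1))"

text \<open>The partial fractions of coth at \<open>x = m y\<close>, divided by \<open>m\<close> and
  cut at \<open>k = K\<close>. The constant \<open>1 / 2\<close> produces the harmonic number, the
  pole term the inverse squares, and the head a double sum over a rectangle.\<close>

lemma lambert_sum_split:
  fixes M K :: nat
  assumes y: "y > 0" and K: "K > 0"
  shows "pi * lambert_sum y M = (\<Sum>m=1..M. \<Sum>k=1..K. y / ((real m * y)\<^sup>2 + (real k)\<^sup>2))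
     + (\<Sum>m=1..M. (\<Sum>j. (real m * y) / ((real m * y)\<^sup>2 + (real (K + Suc j))\<^sup>2)) / real m)
     - pi / 2 * harm M + (\<Sum>m=1..M. 1 / (real m)\<^sup>2) / (2 * y)"
proof -
  have "pi * (1 / real m / (exp (2 * pi * (real m * y)) - 1)) =
     (\<Sum>k=1..K. y / ((real m * y)\<^sup>2 + (real k)\<^sup>2))
     + (\<Sum>j. (real m * y) / ((real m * y)\<^sup>2 + (real (K + Suc j))\<^sup>2)) / real m
     - pi / 2 * inverse (real m) + 1 / (real m)\<^sup>2 / (2 * y)" if m: "m \<in> {1..M}" for m
  proof -
    define x where "x = real m * y"
    have x: "x > 0" using m y by (simp add: x_def)
    define A where "A = (\<Sum>k=1..K. y / (x\<^sup>2 + (real k)\<^sup>2))"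
    define B where "B = (\<Sum>j. x / (x\<^sup>2 + (real (K + Suc j))\<^sup>2))"
    define E where "E = 1 / (exp (2 * pi * x) - 1)"
    have s: "(\<lambda>k. x / (x\<^sup>2 + (real (Suc k))\<^sup>2)) sums (pi * (E + 1 / 2) - 1 / (2 * x))"
      unfolding E_def by (rule coth_partial_fractions[OF x])
    from suminf_split_initial_segment[OF sums_summable[OF s], of K]
    have "pi * (E + 1 / 2) - 1 / (2 * x) = B + (\<Sum>k<K. x / (x\<^sup>2 + (real (Suc k))\<^sup>2))"
      using sums_unique[OF s] by (simp add: B_def add_ac)
    also have "(\<Sum>k<K. x / (x\<^sup>2 + (real (Suc k))\<^sup>2)) = (\<Sum>k=1..K. x / (x\<^sup>2 + (real k)\<^sup>2))"
      by (simp add: sum.atLeast1_atMost_eq)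
    also have "\<dots> = real m * A"
      by (simp add: A_def sum_distrib_left x_def)
    finally have *: "pi * E = B + real m * A - pi / 2 + 1 / (2 * x)" by (simp add: algebra_simps)
    have "pi * E / real m = B / real m + A - pi / 2 * inverse (real m) + 1 / (real m)\<^sup>2 / (2 * y)"
      unfolding * using m y by (simp add: x_def diff_divide_distrib add_divide_distrib inverse_eq_divide power2_eq_square)
    thus ?thesis unfolding A_def B_def E_def x_def[symmetric] by (simp add: mult.commute[of "real m"])
  qed
  thus ?thesis
    by (simp add: lambert_sum_def sum_distrib_left sum.distrib sum_subtractf harm_def sum_divide_distrib
        del: of_nat_add of_nat_Suc)
qed

lemma harm_diff_tendsto:
  assumes "p > 0" "q > 0"
  shows "(\<lambda>n. harm (p * n) - harm (q * n) :: real) \<longlonglongrightarrow> ln (real p / real q)"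
proof -
  have 1: "(\<lambda>n. harm (r * n) - ln (real (r * n)) :: real) \<longlonglongrightarrow> euler_mascheroni" if "r > 0" for r
    by (rule filterlim_compose[OF euler_mascheroni_LIMSEQ]) (use that in real_asymp)
  have "(\<lambda>n. (harm (p * n) - ln (real (p * n)) :: real) - (harm (q * n) - ln (real (q * n))) + ln (real p / real q))
     \<longlonglongrightarrow> euler_mascheroni - euler_mascheroni + ln (real p / real q)"
    by (intro tendsto_intros 1 assms)
  hence "(\<lambda>n. (harm (p * n) - ln (real (p * n)) :: real) - (harm (q * n) - ln (real (q * n))) + ln (real p / real q))
     \<longlonglongrightarrow> ln (real p / real q)" by simp
  thus ?thesis
  proof (rule Lim_transform_eventually)
    show "\<forall>\<^sub>F n in sequentially. (harm (p * n) - ln (real (p * n)) :: real) - (harm (q * n) - ln (real (q * n))) + ln (real p / real q) = harm (p * n) - harm (q * n)"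
      using eventually_gt_at_top[of 0] by eventually_elim (use assms in \<open>simp add: ln_mult ln_div\<close>)
  qed
qed

text \<open>Writing \<open>y = p / q\<close> allows cutoffs whose ratio is exactly \<open>y\<close>:
  passing to \<open>1 / y\<close> swaps the sides of the same rectangle, and the double sum drops
  out. Both tails tend to the same \<open>G\<close>, the harmonic numbers give
  \<open>ln y / 2\<close>, and the inverse squares give the rest.\<close>

lemma lambert_sum_inversion:
  fixes p q :: nat
  assumes p: "p > 0" and q: "q > 0"
  defines "y \<equiv> real p / real q"
  shows "(\<lambda>n. lambert_sum y (q * n) - lambert_sum (1 / y) (p * n))
           \<longlonglongrightarrow> ln y / 2 + pi / 12 * (1 / y - y)"
proof -
  have y: "y > 0" using p q by (simp add: y_def)
  define R :: "nat \<Rightarrow> real" where "R M = (\<Sum>m=1..M. arctan (real m / real M) / real m)" for M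
  define W :: "real \<Rightarrow> nat \<Rightarrow> nat \<Rightarrow> real" where
    "W y M K = (\<Sum>m=1..M. (\<Sum>j. (real m * y) / ((real m * y)\<^sup>2 + (real (K + Suc j))\<^sup>2)) / real m)" for y M K
  define Z :: "nat \<Rightarrow> real" where "Z M = (\<Sum>m=1..M. 1 / (real m)\<^sup>2)" for M
  obtain G where G: "R \<longlonglongrightarrow> G" using arctan_sum_convergent unfolding R_def by blast
  have sub: "filterlim (\<lambda>n. r * n) sequentially sequentially" if "r > 0" for r :: nat
    using that by real_asymp
  have W: "(\<lambda>n. W (real r / real s) (s * n) (r * n)) \<longlonglongrightarrow> G" if rs: "r > 0" "s > 0" for r s
  proof -
    have "\<bar>W (real r / real s) (s * n) (r * n) - R (s * n)\<bar> \<le> 1 / real (r * n)" if n: "n > 0" for n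
      using weighted_arctan_tail_bound[of "s * n" "r * n"] rs n unfolding W_def R_def by simp
    hence "\<forall>\<^sub>F n in sequentially. norm (W (real r / real s) (s * n) (r * n) - R (s * n)) \<le> 1 / real (r * n)"
      by (auto intro!: eventually_mono[OF eventually_gt_at_top[of 0]])
    moreover have "(\<lambda>n. 1 / real (r * n)) \<longlonglongrightarrow> 0" using rs by real_asymp
    ultimately have "(\<lambda>n. W (real r / real s) (s * n) (r * n) - R (s * n)) \<longlonglongrightarrow> 0"
      by (rule Lim_null_comparison)
    from tendsto_add[OF this filterlim_compose[OF G sub[OF rs(2)]]] show ?thesis by simp
  qed
  have Z: "Z \<longlonglongrightarrow> pi\<^sup>2 / 6"
  proof -
    have "(\<lambda>n. \<Sum>k<n. 1 / (real k + 1)\<^sup>2) \<longlonglongrightarrow> pi\<^sup>2 / 6"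
      using inverse_squares_sums by (simp add: sums_def add.commute)
    thus ?thesis unfolding Z_def by (simp add: sum.atLeast1_atMost_eq add.commute)
  qed
  have lim: "(\<lambda>n. (W y (q * n) (p * n) - W (1 / y) (p * n) (q * n)
        + pi / 2 * (harm (p * n) - harm (q * n)) + (Z (q * n) / (2 * y) - Z (p * n) / (2 * (1 / y)))) / pi)
     \<longlonglongrightarrow> (G - G + pi / 2 * ln (real p / real q) + (pi\<^sup>2 / 6 / (2 * y) - pi\<^sup>2 / 6 / (2 * (1 / y)))) / pi"
    using W[OF p q] W[OF q p] y p q
    by (intro tendsto_intros harm_diff_tendsto filterlim_compose[OF Z sub]) (auto simp: y_def)
  also have "(G - G + pi / 2 * ln (real p / real q) + (pi\<^sup>2 / 6 / (2 * y) - pi\<^sup>2 / 6 / (2 * (1 / y)))) / pi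
      = ln y / 2 + pi / 12 * (1 / y - y)"
    using y by (simp add: y_def[symmetric] field_simps power2_eq_square)
  finally show ?thesis
  proof (rule Lim_transform_eventually)
    show "\<forall>\<^sub>F n in sequentially. (W y (q * n) (p * n) - W (1 / y) (p * n) (q * n)
        + pi / 2 * (harm (p * n) - harm (q * n)) + (Z (q * n) / (2 * y) - Z (p * n) / (2 * (1 / y)))) / pi
        = lambert_sum y (q * n) - lambert_sum (1 / y) (p * n)"
      using eventually_gt_at_top[of 0]
    proof eventually_elim
      case (elim n)
      define T where "T = (\<Sum>m=1..q*n. \<Sum>k=1..p*n. y / ((real m * y)\<^sup>2 + (real k)\<^sup>2))"
      \<comment> \<open>Multiplying numerator and denominator by \<open>y^2\<close> and exchanging
        the summations maps one double sum to the other.\<close>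
      have T': "(\<Sum>k=1..p*n. \<Sum>m=1..q*n. (1 / y) / ((real k * (1 / y))\<^sup>2 + (real m)\<^sup>2)) = T"
      proof -
        have "(1 / y) / ((real k * (1 / y))\<^sup>2 + (real m)\<^sup>2) = y / ((real m * y)\<^sup>2 + (real k)\<^sup>2)" for k m
        proof -
          have "(1 / y) / ((real k * (1 / y))\<^sup>2 + (real m)\<^sup>2) = (y\<^sup>2 * (1 / y)) / (y\<^sup>2 * ((real k * (1 / y))\<^sup>2 + (real m)\<^sup>2))"
            using y by simp
          also have "y\<^sup>2 * ((real k * (1 / y))\<^sup>2 + (real m)\<^sup>2) = (real m * y)\<^sup>2 + (real k)\<^sup>2"
            using y by (simp add: algebra_simps power_mult_distrib power_divide)
          also have "y\<^sup>2 * (1 / y) = y" using y by (simp add: power2_eq_square)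
          finally show ?thesis .
        qed
        thus ?thesis unfolding T_def by (subst (2) sum.swap) simp
      qed
      have "pi * lambert_sum y (q * n) = T + W y (q * n) (p * n) - pi / 2 * harm (q * n) + Z (q * n) / (2 * y)"
        unfolding T_def W_def Z_def by (rule lambert_sum_split) (use y p elim in auto)
      moreover have "pi * lambert_sum (1 / y) (p * n) = T + W (1 / y) (p * n) (q * n) - pi / 2 * harm (p * n) + Z (p * n) / (2 * (1 / y))"
        unfolding T'[symmetric] W_def Z_def by (rule lambert_sum_split) (use y q elim in auto)
      ultimately have "pi * (lambert_sum y (q * n) - lambert_sum (1 / y) (p * n)) = W y (q * n) (p * n) - W (1 / y) (p * n) (q * n)
        + pi / 2 * (harm (p * n) - harm (q * n)) + (Z (q * n) / (2 * y) - Z (p * n) / (2 * (1 / y)))"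
        unfolding right_diff_distrib by linarith
      thus ?case by (metis nonzero_mult_div_cancel_left pi_neq_zero)
    qed
  qed
qed

section \<open>The generating function of the Ramanujan tau function\<close>

lemma fps_nth_mult_one_minus_X_power:
  fixes g :: "'a::comm_ring_1 fps"
  assumes "m < k"
  shows "fps_nth (g * (1 - fps_X ^ k) ^ j) m = fps_nth g m"
proof (induction j)
  case (Suc j)
  have "g * (1 - fps_X ^ k) ^ Suc j = g * (1 - fps_X ^ k) ^ j - (g * (1 - fps_X ^ k) ^ j) * fps_X ^ k"
    by (simp add: algebra_simps)
  thus ?case using Suc assms by (simp add: fps_X_power_mult_right_nth)
qed auto

text \<open>Polymorphic in the coefficient ring: the integer version determines
  \<open>ramanujan_tau\<close>, the complex one is the Taylor expansion of an analytic
  product.\<close>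

definition euler_partial_product :: "nat \<Rightarrow> 'a::comm_ring_1 fps" where
  "euler_partial_product N = (\<Prod>n\<le>N. (1 - fps_X ^ Suc n) ^ 24)"

lemma euler_partial_product_Suc:
  "euler_partial_product (Suc N) = euler_partial_product N * (1 - fps_X ^ Suc (Suc N)) ^ 24"
  by (simp add: euler_partial_product_def)

lemma euler_partial_product_stable:
  assumes "m \<le> N"
  shows "fps_nth (euler_partial_product N) m = fps_nth (euler_partial_product m :: 'a::comm_ring_1 fps) m"
  using assms
proof (induction N rule: dec_induct)
  case (step N)
  thus ?case by (simp add: euler_partial_product_Suc fps_nth_mult_one_minus_X_power del: power_Suc)
qed auto

text \<open>Each coefficient of the partial products is eventually constant, so the series of these
  stable coefficients is their q-adic limit and hence the value of \<open>prodinf\<close>.\<close>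

lemma ramanujan_tau_eq_nth:
  assumes "m \<le> N"
  shows "ramanujan_tau m = fps_nth (fps_X * euler_partial_product N) m"
proof -
  define L :: "int fps" where "L = Abs_fps (\<lambda>m. fps_nth (euler_partial_product m) m)"
  have "euler_partial_product \<longlonglongrightarrow> L"
  proof (rule tendsto_fpsI)
    fix n show "\<forall>\<^sub>F x in sequentially. fps_nth (euler_partial_product x) n = fps_nth L n"
      using eventually_ge_at_top[of n] by eventually_elim (unfold L_def fps_nth_Abs_fps, rule euler_partial_product_stable)
  qed
  \<comment> \<open>\<open>has_prod\<close> demands a nonzero limit, which the constant coefficient
    provides.\<close>
  moreover have "fps_nth L 0 = 1"
    by (simp add: L_def euler_partial_product_def fps_nth_power_0)
  hence "L \<noteq> 0" by auto
  ultimately have "(\<lambda>n. (1 - fps_X ^ Suc n) ^ 24) has_prod L"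
    by (simp add: has_prod_def raw_has_prod_def euler_partial_product_def[abs_def])
  hence "prodinf (\<lambda>n. (1 - fps_X ^ Suc n) ^ 24) = L"
    by (rule has_prod_unique[symmetric])
  thus ?thesis using assms
    using euler_partial_product_stable[of "m - 1" N, where 'a = int] by (cases m) (auto simp: ramanujan_tau_def L_def)
qed

definition fps_complex_of_int :: "int fps \<Rightarrow> complex fps" where
  "fps_complex_of_int f = Abs_fps (\<lambda>n. of_int (fps_nth f n))"

lemma fps_complex_of_int_simps:
  "fps_complex_of_int (f * g) = fps_complex_of_int f * fps_complex_of_int g"
  "fps_complex_of_int (f - g) = fps_complex_of_int f - fps_complex_of_int g"
  "fps_complex_of_int 1 = 1" "fps_complex_of_int fps_X = fps_X"
  by (auto simp: fps_complex_of_int_def fps_eq_iff fps_mult_nth fps_X_def)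

lemma fps_complex_of_int_power: "fps_complex_of_int (f ^ n) = fps_complex_of_int f ^ n"
  by (induction n) (simp_all add: fps_complex_of_int_simps)

lemma fps_complex_of_int_euler_partial_product:
  "fps_complex_of_int (euler_partial_product N) = euler_partial_product N"
proof (induction N)
  case (Suc N)
  thus ?case by (simp only: euler_partial_product_Suc fps_complex_of_int_simps fps_complex_of_int_power)
qed (simp add: euler_partial_product_def fps_complex_of_int_simps fps_complex_of_int_power del: power_Suc)

text \<open>The modular discriminant as a function of the nome; starting at \<open>m = 0\<close>
  adds nothing, since \<open>ramanujan_tau 0 = 0\<close>.\<close>

definition discriminant_disc :: "complex \<Rightarrow> complex" where
  "discriminant_disc q = (\<Sum>m. of_int (ramanujan_tau m) * q ^ m)"

text \<open>The partial products converge uniformly on smaller discs, so the Taylor coefficients of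
  the limit are the limits of theirs. Those are eventually constant and equal to
  \<open>ramanujan_tau\<close>; thus the formal and the analytic product agree.\<close>

lemma
  fixes q :: complex
  assumes "norm q < 1"
  shows discriminant_disc_sums: "(\<lambda>m. of_int (ramanujan_tau m) * q ^ m) sums discriminant_disc q"
    and discriminant_disc_product: "(\<lambda>N. q * (\<Prod>n<N. (1 - q ^ Suc n) ^ 24)) \<longlonglongrightarrow> discriminant_disc q"
proof -
  obtain r where r: "norm q < r" "r < 1" using assms dense by blast
  have r0: "r > 0" using r norm_ge_zero[of q] by linarith
  have "uniformly_convergent_on (cball 0 r) (\<lambda>N q::complex. \<Prod>n<N. 1 - q ^ Suc n)"
  proof (rule uniformly_convergent_on_prod')
    show "uniformly_convergent_on (cball 0 r) (\<lambda>N x. \<Sum>n<N. norm (1 - x ^ Suc n - 1 :: complex))"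
    proof (rule Weierstrass_m_test'[where M = "\<lambda>n. r ^ Suc n"])
      show "summable (\<lambda>n. r ^ Suc n)" using r r0 by (subst summable_Suc_iff) (auto intro: summable_geometric)
    qed (use r r0 in \<open>auto simp: norm_mult norm_power intro!: mult_mono power_mono\<close>)
  qed (auto intro!: continuous_intros)
  then obtain g where g: "uniform_limit (cball 0 r) (\<lambda>N q::complex. \<Prod>n<N. 1 - q ^ Suc n) g sequentially"
    by (auto simp: uniformly_convergent_on_def)
  define G where "G q = q * g q ^ 24" for q
  have cg: "continuous_on (cball 0 r) g"
    by (rule uniform_limit_theorem[OF _ g]) (auto intro!: always_eventually continuous_intros)
  have bg: "bounded (g ` cball 0 r)"
    by (rule compact_imp_bounded[OF compact_continuous_image[OF cg compact_cball]])
  \<comment> \<open>Multiplying uniform limits requires bounded limit functions; \<open>g\<close> is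
    continuous on a compact disc.\<close>
  have pow: "uniform_limit (cball 0 r) (\<lambda>N q. (\<Prod>n<N. 1 - q ^ Suc n) ^ j) (\<lambda>q. g q ^ j) sequentially" for j
  proof (induction j)
    case (Suc j)
    have "uniform_limit (cball 0 r) (\<lambda>N q. (\<Prod>n<N. 1 - q ^ Suc n) * (\<Prod>n<N. 1 - q ^ Suc n) ^ j) (\<lambda>q. g q * g q ^ j) sequentially"
      using bg cg by (intro uniform_lim_mult g Suc compact_imp_bounded compact_continuous_image continuous_intros) auto
    thus ?case by simp
  qed (simp add: uniform_limit_const)
  have "uniform_limit (cball 0 r) (\<lambda>N q. q * (\<Prod>n<N. 1 - q ^ Suc n) ^ 24) (\<lambda>q. q * g q ^ 24) sequentially"
    using cg by (intro uniform_lim_mult pow uniform_limit_const compact_imp_bounded compact_continuous_image continuous_intros) auto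
  hence lim: "uniform_limit (cball 0 r) (\<lambda>N q. q * (\<Prod>n<N. (1 - q ^ Suc n) ^ 24)) G sequentially"
    by (simp add: G_def[abs_def] prod_power_distrib)
  have lim': "uniform_limit (ball 0 r) (\<lambda>N q. q * (\<Prod>n\<le>N. (1 - q ^ Suc n) ^ 24)) G sequentially"
    using uniform_limit_on_subset[OF filterlim_compose[OF lim[unfolded] filterlim_Suc]]
    by (auto simp: lessThan_Suc_atMost ball_subset_cball)
  have holo: "(\<lambda>q. q * (\<Prod>n\<le>N. (1 - q ^ Suc n) ^ 24)) holomorphic_on A" for N A
    by (intro holomorphic_intros)
  have holG: "G holomorphic_on ball 0 r"
  proof (rule holomorphic_uniform_sequence[OF open_ball])
    fix x :: complex assume "x \<in> ball 0 r"
    then obtain d where "d > 0" "cball x d \<subseteq> ball 0 r" by (meson open_ball open_contains_cball)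
    thus "\<exists>d>0. cball x d \<subseteq> ball 0 r \<and>
        uniform_limit (cball x d) (\<lambda>N q. q * (\<Prod>n\<le>N. (1 - q ^ Suc n) ^ 24)) G sequentially"
      using uniform_limit_on_subset[OF lim'] by blast
  qed (rule holo)
  define H :: "complex fps" where "H = Abs_fps (\<lambda>m. of_int (ramanujan_tau m))"
  have "fps_expansion G 0 = H"
  proof (rule uniform_limit_imp_fps_expansion_eq[OF _ lim'])
    show "(\<lambda>N. fps_X * euler_partial_product N) \<longlonglongrightarrow> H"
    proof (rule tendsto_fpsI)
      fix n show "\<forall>\<^sub>F N in sequentially. fps_nth (fps_X * euler_partial_product N) n = fps_nth H n"
        using eventually_ge_at_top[of n]
      proof eventually_elim
        case (elim N)
        have "fps_nth H n = fps_nth (fps_complex_of_int (fps_X * euler_partial_product N)) n"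
          unfolding H_def ramanujan_tau_eq_nth[OF elim] by (simp add: ramanujan_tau_eq_nth[OF elim] fps_complex_of_int_def)
        thus ?case by (simp add: fps_complex_of_int_simps fps_complex_of_int_euler_partial_product)
      qed
    qed
    show "\<forall>\<^sub>F N in sequentially. (\<lambda>q. q * (\<Prod>n\<le>N. (1 - q ^ Suc n) ^ 24)) has_fps_expansion fps_X * euler_partial_product N"
      unfolding euler_partial_product_def by (intro always_eventually allI fps_expansion_intros)
    show "G has_fps_expansion fps_expansion G 0"
      by (intro has_fps_expansion_fps_expansion[OF open_ball _ holG]) (use r0 in auto)
  qed (use r0 holo in auto)
  hence co: "(deriv ^^ n) G 0 / fact n = of_int (ramanujan_tau n)" for n
    by (auto simp: fps_expansion_def H_def fps_eq_iff)
  have q: "q \<in> ball 0 r" using r by auto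
  have s: "(\<lambda>m. of_int (ramanujan_tau m) * q ^ m) sums G q"
    using holomorphic_power_series[OF holG q] by (simp add: co)
  have Gq: "G q = discriminant_disc q" using sums_unique[OF s] by (simp add: discriminant_disc_def)
  show "(\<lambda>m. of_int (ramanujan_tau m) * q ^ m) sums discriminant_disc q" using s Gq by simp
  show "(\<lambda>N. q * (\<Prod>n<N. (1 - q ^ Suc n) ^ 24)) \<longlonglongrightarrow> discriminant_disc q"
    using tendsto_uniform_limitI[OF lim, of q] r Gq by auto
qed

lemma summable_norm_ramanujan_tau_power:
  assumes "r \<ge> 0" "r < 1"
  shows "summable (\<lambda>m. \<bar>of_int (ramanujan_tau m)\<bar> * r ^ m :: real)"
proof -
  obtain s where s: "r < s" "s < 1" using assms dense by blast
  have "summable (\<lambda>m. of_int (ramanujan_tau m) * (of_real s :: complex) ^ m)"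
    by (rule sums_summable[OF discriminant_disc_sums]) (use s assms in auto)
  from powser_insidea[OF this, of "of_real r"] s assms
  show ?thesis by (simp add: norm_mult norm_power)
qed

lemma holomorphic_discriminant_disc: "discriminant_disc holomorphic_on ball 0 1"
proof -
  have "(\<lambda>m. of_int (ramanujan_tau m) * (w - 0) ^ m) sums discriminant_disc w" if "w \<in> ball 0 1" for w
    using discriminant_disc_sums[of w] that by simp
  thus ?thesis by (rule power_series_holomorphic)
qed

lemma ramanujan_tau_0 [simp]: "ramanujan_tau 0 = 0"
  by (simp add: ramanujan_tau_def)

section \<open>The logarithm of the product as a Lambert series\<close>

lemma minus_ln_one_minus_sums:
  fixes x :: real
  assumes "0 \<le> x" "x < 1"
  shows "(\<lambda>m. x ^ Suc m / real (Suc m)) sums (- ln (1 - x))"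
proof -
  have "(\<lambda>n. - (- ((-(-x))^n) / of_nat n)) sums (- ln (1 + (-x)))"
    by (intro sums_minus ln_series') (use assms in auto)
  hence "(\<lambda>n. x ^ n / real n) sums (- ln (1 - x))" by simp
  thus ?thesis by (subst sums_Suc_iff) simp
qed

text \<open>Tonelli for the nonnegative double series of \<open>r ^ (m n) / m\<close>: summing over
  \<open>m\<close> first gives the logarithms, over \<open>n\<close> first the geometric series
  behind the Lambert terms.\<close>

lemma
  fixes r :: real
  assumes r: "0 < r" "r < 1"
  shows summable_ln_one_minus_power: "summable (\<lambda>n. ln (1 - r ^ Suc n))"
    and lambert_series_sums:
      "(\<lambda>m. 1 / real (Suc m) * (r ^ Suc m / (1 - r ^ Suc m))) sums (- (\<Sum>n. ln (1 - r ^ Suc n)))"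
proof -
  have rn: "0 < r ^ Suc n" "r ^ Suc n < 1" for n
    using r power_Suc_less_one[of r n] by auto
  have ln_le: "- ln (1 - x) \<le> x / (1 - x)" if "0 < x" "x < 1" for x :: real
  proof -
    have "ln (1 / (1 - x)) \<le> 1 / (1 - x) - 1" using that by (intro ln_le_minus_one) auto
    moreover have "1 / (1 - x) - 1 = x / (1 - x)" using that by (simp add: field_simps)
    ultimately show ?thesis using that by (simp add: ln_div)
  qed
  have smr: "summable (\<lambda>n. r ^ Suc n / (1 - r))"
    using r by (intro summable_divide) (subst summable_Suc_iff, auto intro: summable_geometric)
  have sm: "summable (\<lambda>n. - ln (1 - r ^ Suc n))"
  proof (rule summable_comparison_test'[OF smr, of 0])
    fix n
    have "- ln (1 - r ^ Suc n) \<ge> 0" using rn[of n] by (simp del: power_Suc)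
    moreover have "- ln (1 - r ^ Suc n) \<le> r ^ Suc n / (1 - r ^ Suc n)" by (rule ln_le[OF rn])
    moreover have "r ^ Suc n / (1 - r ^ Suc n) \<le> r ^ Suc n / (1 - r)"
      using rn[of n] r power_decreasing[of 1 "Suc n" r] by (intro divide_left_mono) (auto simp del: power_Suc)
    ultimately show "norm (- ln (1 - r ^ Suc n)) \<le> r ^ Suc n / (1 - r)" by (simp del: power_Suc)
  qed
  show "summable (\<lambda>n. ln (1 - r ^ Suc n))" using sm by (subst (asm) summable_minus_iff)
  define f where "f = (\<lambda>(n, m). (r ^ Suc n) ^ Suc m / real (Suc m))"
  have f0: "f (n, m) \<ge> 0" for n m using r by (simp add: f_def)
  have f1: "((\<lambda>m. f (n, m)) has_sum (- ln (1 - r ^ Suc n))) UNIV" for n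
    unfolding f_def using minus_ln_one_minus_sums[of "r ^ Suc n"] rn[of n] r
    by (intro sums_nonneg_imp_has_sum) (auto simp del: power_Suc)
  have pos: "- ln (1 - r ^ Suc n) \<ge> 0" for n using rn[of n] by (simp del: power_Suc)
  have f2: "((\<lambda>n. - ln (1 - r ^ Suc n)) has_sum (\<Sum>n. - ln (1 - r ^ Suc n))) UNIV"
    by (intro sums_nonneg_imp_has_sum summable_sums sm pos)
  have "f summable_on (UNIV \<times> UNIV)"
    by (rule summable_on_SigmaI[OF f1]) (use f2 f0 in \<open>auto simp: summable_on_def\<close>)
  from has_sum_SigmaI[OF f1 f2 this] have "(f has_sum (\<Sum>n. - ln (1 - r ^ Suc n))) (UNIV \<times> UNIV)" .
  hence sw: "((\<lambda>(m, n). f (n, m)) has_sum (\<Sum>n. - ln (1 - r ^ Suc n))) (UNIV \<times> UNIV)"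
    by (subst (asm) has_sum_swap) 
  have f3: "((\<lambda>n. f (n, m)) has_sum (1 / real (Suc m) * (r ^ Suc m / (1 - r ^ Suc m)))) UNIV" for m
  proof (rule sums_nonneg_imp_has_sum)
    have "(\<lambda>n. (r ^ Suc m) ^ n) sums (1 / (1 - r ^ Suc m))"
      using rn[of m] by (intro geometric_sums) (simp del: power_Suc)
    from sums_mult[OF this, of "r ^ Suc m / real (Suc m)"]
    show "(\<lambda>n. f (n, m)) sums (1 / real (Suc m) * (r ^ Suc m / (1 - r ^ Suc m)))"
      by (simp add: f_def power_mult_distrib mult_ac flip: power_mult power_Suc power_add)
         (simp add: mult_ac power_add power_mult)
  qed (rule f0)
  have "((\<lambda>m. 1 / real (Suc m) * (r ^ Suc m / (1 - r ^ Suc m))) has_sum (\<Sum>n. - ln (1 - r ^ Suc n))) UNIV"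
    by (rule has_sum_SigmaD[OF sw]) (use f3 in auto)
  from has_sum_imp_sums[OF this]
  show "(\<lambda>m. 1 / real (Suc m) * (r ^ Suc m / (1 - r ^ Suc m))) sums (- (\<Sum>n. ln (1 - r ^ Suc n)))"
    using sm by (subst (asm) suminf_minus) (auto simp: summable_minus_iff del: power_Suc)
qed

lemma discriminant_disc_of_real:
  fixes r :: real
  assumes r: "0 < r" "r < 1"
  shows "discriminant_disc (of_real r) = of_real (exp (ln r + 24 * (\<Sum>n. ln (1 - r ^ Suc n))))"
proof -
  have rn: "r ^ Suc n < 1" for n using r power_Suc_less_one[of r n] by auto
  have "(\<lambda>N. exp (ln r + 24 * (\<Sum>n<N. ln (1 - r ^ Suc n)))) \<longlonglongrightarrow> exp (ln r + 24 * (\<Sum>n. ln (1 - r ^ Suc n)))"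
    by (intro tendsto_intros summable_LIMSEQ summable_ln_one_minus_power r)
  also have "(\<lambda>N. exp (ln r + 24 * (\<Sum>n<N. ln (1 - r ^ Suc n)))) = (\<lambda>N. r * (\<Prod>n<N. (1 - r ^ Suc n) ^ 24))"
  proof
    fix N
    have "exp (24 * (\<Sum>n<N. ln (1 - r ^ Suc n))) = (exp (\<Sum>n<N. ln (1 - r ^ Suc n))) ^ 24"
      using exp_of_nat_mult[of 24 "\<Sum>n<N. ln (1 - r ^ Suc n)"] by simp
    also have "exp (\<Sum>n<N. ln (1 - r ^ Suc n)) = (\<Prod>n<N. 1 - r ^ Suc n)"
      using rn by (simp add: exp_sum del: power_Suc)
    finally show "exp (ln r + 24 * (\<Sum>n<N. ln (1 - r ^ Suc n))) = r * (\<Prod>n<N. (1 - r ^ Suc n) ^ 24)"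
      using r by (simp add: exp_add prod_power_distrib del: power_Suc)
  qed
  finally have "(\<lambda>N. complex_of_real (r * (\<Prod>n<N. (1 - r ^ Suc n) ^ 24))) \<longlonglongrightarrow> of_real (exp (ln r + 24 * (\<Sum>n. ln (1 - r ^ Suc n))))"
    by (rule tendsto_of_real)
  moreover have "(\<lambda>N. complex_of_real (r * (\<Prod>n<N. (1 - r ^ Suc n) ^ 24))) \<longlonglongrightarrow> discriminant_disc (of_real r)"
    using discriminant_disc_product[of "of_real r"] r by simp
  ultimately show ?thesis using LIMSEQ_unique by blast
qed

text \<open>The cusp form of weight 12 in the half-plane variable; the nome lies in the unit disc
  exactly for \<open>Im z > 0\<close>.\<close>

definition discriminant :: "complex \<Rightarrow> complex" where
  "discriminant z = discriminant_disc (exp (2 * of_real pi * \<i> * z))"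

lemma lambert_sum_tendsto:
  assumes y: "y > 0"
  shows "lambert_sum y \<longlonglongrightarrow> - (\<Sum>n. ln (1 - exp (- 2 * pi * y) ^ Suc n))"
proof -
  define r where "r = exp (- 2 * pi * y)"
  have r: "0 < r" "r < 1" using y by (auto simp: r_def)
  have "(\<lambda>M. \<Sum>m<M. 1 / real (Suc m) * (r ^ Suc m / (1 - r ^ Suc m))) \<longlonglongrightarrow> - (\<Sum>n. ln (1 - r ^ Suc n))"
    using lambert_series_sums[OF r] by (simp add: sums_def)
  also have "(\<lambda>M. \<Sum>m<M. 1 / real (Suc m) * (r ^ Suc m / (1 - r ^ Suc m))) = lambert_sum y"
  proof
    fix M
    have "r ^ m / (1 - r ^ m) = 1 / (exp (2 * pi * (real m * y)) - 1)" if "m > 0" for m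
    proof -
      have "r ^ m = inverse (exp (2 * pi * (real m * y)))"
        by (simp add: r_def mult_ac flip: exp_of_nat_mult exp_minus)
      moreover have "inverse e / (1 - inverse e) = 1 / (e - 1)" if "e > 1" for e :: real
        using that by (simp add: field_simps)
      moreover have "exp (2 * pi * (real m * y)) > 1" using that y by simp
      ultimately show ?thesis by simp
    qed
    hence "1 / real (Suc m) * (r ^ Suc m / (1 - r ^ Suc m)) = 1 / real (Suc m) / (exp (2 * pi * (real (Suc m) * y)) - 1)" for m
      by (simp del: power_Suc of_nat_Suc)
    thus "(\<Sum>m<M. 1 / real (Suc m) * (r ^ Suc m / (1 - r ^ Suc m))) = lambert_sum y M"
      unfolding lambert_sum_def by (simp add: sum.atLeast1_atMost_eq del: power_Suc of_nat_Suc)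
  qed
  finally show ?thesis by (simp add: r_def)
qed

lemma discriminant_imaginary_axis:
  assumes y: "y > 0"
  shows "discriminant (\<i> * of_real y) = of_real (exp (- 2 * pi * y + 24 * (\<Sum>n. ln (1 - exp (- 2 * pi * y) ^ Suc n))))"
proof -
  have "exp (2 * of_real pi * \<i> * (\<i> * of_real y)) = complex_of_real (exp (- 2 * pi * y))"
    unfolding exp_of_real[symmetric] by (rule arg_cong[where f = exp]) (simp add: complex_eq_iff)
  thus ?thesis unfolding discriminant_def using discriminant_disc_of_real[of "exp (- 2 * pi * y)"] y by simp
qed

text \<open>Both Lambert sums converge, so \<open>lambert_sum_inversion\<close> compares the
  logarithms of the two products. Multiplied by 24, \<open>ln y / 2\<close> becomes the weight
  factor \<open>y ^ 12\<close>, and \<open>pi / 12 * (1 / y - y)\<close> accounts for the leading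
  factors \<open>exp (- 2 pi y)\<close> and \<open>exp (- 2 pi / y)\<close>.\<close>

lemma discriminant_inversion_rational:
  fixes p q :: nat
  assumes p: "p > 0" and q: "q > 0"
  defines "y \<equiv> real p / real q"
  shows "discriminant (\<i> * of_real (1 / y)) = of_real y ^ 12 * discriminant (\<i> * of_real y)"
proof -
  have y: "y > 0" using p q by (simp add: y_def)
  define A where "A y = (\<Sum>n. ln (1 - exp (- 2 * pi * y) ^ Suc n))" for y :: real
  have "filterlim (\<lambda>n. r * n) sequentially sequentially" if "r > 0" for r :: nat
    using that by real_asymp
  hence "(\<lambda>n. lambert_sum y (q * n) - lambert_sum (1 / y) (p * n)) \<longlonglongrightarrow> - A y - (- A (1 / y))"
    unfolding A_def using p q y
    by (intro tendsto_diff filterlim_compose[OF lambert_sum_tendsto]) auto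
  from LIMSEQ_unique[OF this lambert_sum_inversion[OF p q, folded y_def]]
  have A: "A (1 / y) = A y + ln y / 2 + pi / 12 * (1 / y - y)" by simp
  have "- 2 * pi * (1 / y) + 24 * A (1 / y) = 12 * ln y + (- 2 * pi * y + 24 * A y)"
    unfolding A using y by (simp add: field_simps)
  hence "exp (- 2 * pi * (1 / y) + 24 * A (1 / y)) = exp (12 * ln y) * exp (- 2 * pi * y + 24 * A y)"
    by (simp only: exp_add)
  also have "exp (12 * ln y) = y ^ 12"
    using exp_of_nat_mult[of 12 "ln y"] y by simp
  finally have "complex_of_real (exp (- 2 * pi * (1 / y) + 24 * A (1 / y))) = of_real y ^ 12 * of_real (exp (- 2 * pi * y + 24 * A y))"
    by simp
  thus ?thesis using discriminant_imaginary_axis[of y] discriminant_imaginary_axis[of "1 / y"] y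
    unfolding A_def by simp
qed

section \<open>Modularity and the mean square of the coefficients\<close>

lemma norm_exp_2pi_i: "norm (exp (2 * of_real pi * \<i> * z)) = exp (- 2 * pi * Im z)"
  by simp

lemma holomorphic_discriminant: "discriminant holomorphic_on {z. Im z > 0}"
proof -
  have "discriminant_disc \<circ> (\<lambda>z. exp (2 * of_real pi * \<i> * z)) holomorphic_on {z. Im z > 0}"
    by (rule holomorphic_on_compose_gen[OF _ holomorphic_discriminant_disc])
       (auto intro!: holomorphic_intros)
  thus ?thesis by (simp add: discriminant_def[abs_def] o_def)
qed

lemma discriminant_minus_of_int: "discriminant (z - of_int n) = discriminant z"
proof -
  have "exp (2 * of_real pi * \<i> * (z - of_int n)) = exp (2 * of_real pi * \<i> * z + of_int (- n) * (2 * of_real pi * \<i>))"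
    by (simp add: algebra_simps)
  also have "\<dots> = exp (2 * of_real pi * \<i> * z)"
    unfolding exp_eq by (intro exI[of _ "- n"]) (simp add: algebra_simps)
  finally show ?thesis by (simp add: discriminant_def)
qed

text \<open>Both sides are holomorphic in the upper half-plane and agree at rational points of the
  imaginary axis. No sign appears, since \<open>i ^ 12 = 1\<close>.\<close>

lemma discriminant_inversion:
  assumes z: "Im z > 0"
  shows "discriminant (- 1 / z) = z ^ 12 * discriminant z"
proof -
  let ?H = "{z. Im z > 0}"
  \<comment> \<open>Rational heights different from 1 that tend to 1.\<close>
  define U where "U = range (\<lambda>n::nat. \<i> * of_real (real (n + 2) / real (n + 1)))"
  have im: "Im (- 1 / w) > 0" if "Im w > 0" for w
    using that by (auto simp: Im_divide intro!: divide_pos_pos add_nonneg_pos)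
  have "(discriminant \<circ> (\<lambda>z. - 1 / z)) holomorphic_on ?H"
    by (rule holomorphic_on_compose_gen[OF _ holomorphic_discriminant])
       (use im in \<open>auto intro!: holomorphic_intros\<close>)
  hence "(\<lambda>z. discriminant (- 1 / z) - z ^ 12 * discriminant z) holomorphic_on ?H"
    using holomorphic_discriminant by (intro holomorphic_intros) (auto simp: o_def)
  hence "discriminant (- 1 / z) - z ^ 12 * discriminant z = 0"
  proof (rule analytic_continuation[where U = U and \<xi> = \<i>])
    show "open ?H" by (rule open_halfspace_Im_gt)
    show "connected ?H" by (intro convex_connected convex_halfspace_Im_gt)
    show "U \<subseteq> ?H" by (auto simp: U_def)
    show "\<i> islimpt U" unfolding islimpt_sequential
    proof (intro exI conjI allI)
      show "\<i> * of_real (real (n + 2) / real (n + 1)) \<in> U - {\<i>}" for n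
        by (auto simp: U_def complex_eq_iff)
      have "(\<lambda>n. real (n + 2) / real (n + 1)) \<longlonglongrightarrow> 1" by real_asymp
      from tendsto_mult[OF tendsto_const tendsto_of_real[OF this], of \<i>]
      show "(\<lambda>n. \<i> * of_real (real (n + 2) / real (n + 1))) \<longlonglongrightarrow> \<i>" by simp
    qed
    fix w assume "w \<in> U"
    then obtain n :: nat where w: "w = \<i> * of_real (real (n + 2) / real (n + 1))" by (auto simp: U_def)
    define y where "y = real (n + 2) / real (n + 1)"
    have y: "y > 0" by (simp add: y_def)
    have "- 1 / (\<i> * of_real y) = \<i> * of_real (1 / y)"
      using y by (simp add: complex_eq_iff Re_divide Im_divide power2_eq_square)
    hence "- 1 / w = \<i> * of_real (1 / y)" by (simp only: w y_def)
    moreover have "w ^ 12 = of_real y ^ 12"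
    proof -
      have "\<i> ^ 12 = (\<i>\<^sup>2) ^ 6" by (simp only: power_mult[symmetric]) simp
      hence "\<i> ^ 12 = 1" by simp
      thus ?thesis unfolding w y_def[symmetric] power_mult_distrib by simp
    qed
    ultimately show "discriminant (- 1 / w) - w ^ 12 * discriminant w = 0"
      using discriminant_inversion_rational[of "n + 2" "n + 1"] by (simp add: w y_def del: of_nat_add)
  qed (use z in auto)
  thus ?thesis by simp
qed

text \<open>As \<open>ramanujan_tau 0 = 0\<close>, one factor of the nome splits off; the remaining
  series is dominated by its absolute values at radius \<open>exp (- pi)\<close>, the size of the
  nome at height \<open>1 / 2\<close>.\<close>

lemma norm_discriminant_le_cusp:
  "\<exists>C>0. \<forall>z. Im z \<ge> 1 / 2 \<longrightarrow> norm (discriminant z) \<le> C * exp (- 2 * pi * Im z)"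
proof -
  define \<rho> where "\<rho> = exp (- pi)"
  have rho: "0 < \<rho>" "\<rho> < 1" by (auto simp: \<rho>_def)
  define a where "a m = \<bar>of_int (ramanujan_tau m) :: real\<bar>" for m
  have s: "summable (\<lambda>m. a m * \<rho> ^ m)"
    unfolding a_def using rho by (intro summable_norm_ramanujan_tau_power) auto
  hence "summable (\<lambda>m. inverse \<rho> * (a (Suc m) * \<rho> ^ Suc m))"
    by (intro summable_mult) (subst summable_Suc_iff)
  hence s': "summable (\<lambda>m. a (Suc m) * \<rho> ^ m)" using rho by (simp add: field_simps)
  define C where "C = (\<Sum>m. a (Suc m) * \<rho> ^ m)"
  have C: "C \<ge> 0" unfolding C_def using rho by (intro suminf_nonneg s') (auto simp: a_def)
  have "norm (discriminant z) \<le> (C + 1) * exp (- 2 * pi * Im z)" if z: "Im z \<ge> 1 / 2" for z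
  proof -
    define q where "q = exp (2 * of_real pi * \<i> * z)"
    have nq: "norm q = exp (- 2 * pi * Im z)" unfolding q_def by (rule norm_exp_2pi_i)
    have q: "norm q \<le> \<rho>" unfolding nq \<rho>_def using z by simp
    have "(\<lambda>m. of_int (ramanujan_tau m) * q ^ m) sums discriminant z"
      unfolding discriminant_def q_def[symmetric] by (rule discriminant_disc_sums) (use q rho in auto)
    hence sz: "(\<lambda>m. of_int (ramanujan_tau (Suc m)) * q ^ Suc m) sums discriminant z"
      by (subst sums_Suc_iff) simp
    have "norm (discriminant z) \<le> (\<Sum>m. norm q * (a (Suc m) * \<rho> ^ m))"
      unfolding sums_unique[OF sz]
    proof (rule norm_suminf_le)
      fix m
      have "norm (of_int (ramanujan_tau (Suc m)) * q ^ Suc m) = norm q * (a (Suc m) * norm q ^ m)"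
        by (simp add: norm_mult norm_power a_def)
      also have "\<dots> \<le> norm q * (a (Suc m) * \<rho> ^ m)"
        using q by (intro mult_left_mono power_mono) (auto simp: a_def)
      finally show "norm (of_int (ramanujan_tau (Suc m)) * q ^ Suc m) \<le> norm q * (a (Suc m) * \<rho> ^ m)" .
    qed (intro summable_mult s')
    also have "\<dots> = C * norm q" using suminf_mult[OF s', of "norm q"] by (simp add: C_def)
    also have "\<dots> \<le> (C + 1) * norm q" by (simp add: mult_right_mono)
    finally show ?thesis by (simp add: nq)
  qed
  thus ?thesis using C by (intro exI[of _ "C + 1"]) auto
qed

text \<open>
  The function \<open>(Im z) ^ 6 * norm (discriminant z)\<close> is invariant under translation and inversion.
  Below height \<open>1 / 2\<close>, a translation into \<open>\<bar>Re z\<bar> \<le> 1 / 2\<close> followed by the inversion at least doubles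
  the height, so no fundamental domain is needed to reduce to the cusp.
\<close>

lemma norm_discriminant_le:
  obtains C where "C > 0" "\<And>z. Im z > 0 \<Longrightarrow> (Im z) ^ 6 * norm (discriminant z) \<le> C"
proof -
  obtain C where C: "C > 0" "\<And>z. Im z \<ge> 1 / 2 \<Longrightarrow> norm (discriminant z) \<le> C * exp (- 2 * pi * Im z)"
    using norm_discriminant_le_cusp by blast
  \<comment> \<open>Induction on the number of doublings that suffice to reach height
    \<open>1 / 2\<close>; the same \<open>C\<close> survives every step.\<close>
  have main: "Im z \<ge> 1 / 2 / 2 ^ k \<Longrightarrow> (Im z) ^ 6 * norm (discriminant z) \<le> C" for k z
  proof (induction k arbitrary: z)
    case 0
    define y where "y = Im z"
    have y: "y \<ge> 1 / 2" using 0 by (simp add: y_def)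
    \<comment> \<open>Because \<open>6 \<le> 2 pi\<close>, the decay at the cusp beats
      \<open>y ^ 6\<close> without enlarging \<open>C\<close>.\<close>
    have "y ^ 6 \<le> exp y ^ 6" using y order_trans[OF _ exp_ge_add_one_self[of y], of y] by (intro power_mono) auto
    also have "\<dots> = exp (6 * y)" using exp_of_nat_mult[of 6 y] by simp
    also have "\<dots> \<le> exp (2 * pi * y)" using pi_gt3 y by (simp add: mult_right_mono)
    finally have y6: "y ^ 6 \<le> exp (2 * pi * y)" .
    have "y ^ 6 * norm (discriminant z) \<le> exp (2 * pi * y) * (C * exp (- 2 * pi * y))"
      unfolding y_def using y y6 0 by (intro mult_mono C(2)) (auto simp: y_def)
    also have "\<dots> = C" by (simp add: exp_minus field_simps)
    finally show ?case by (simp add: y_def)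
  next
    case (Suc k)
    show ?case
    proof (cases "Im z \<ge> 1 / 2")
      case True
      have "1 / 2 / 2 ^ k \<le> 1 / 2 / (1 :: real)" by (intro divide_left_mono) auto
      thus ?thesis using True by (intro Suc.IH) linarith
    next
      case False
      have zpos: "Im z > 0" by (rule less_le_trans[OF _ Suc.prems]) simp
      define w where "w = z - of_int (round (Re z))"
      have Imw: "Im w = Im z" by (simp add: w_def)
      have "\<bar>Re w\<bar> \<le> 1 / 2" using of_int_round_abs_le[of "Re z"] by (simp add: w_def abs_minus_commute)
      hence "(Re w)\<^sup>2 \<le> (1 / 2)\<^sup>2" by (simp add: abs_le_square_iff[symmetric])
      moreover have "(Im w)\<^sup>2 \<le> (1 / 2)\<^sup>2" using False zpos Imw by (intro power_mono) auto
      \<comment> \<open>The source of the doubling: inversion divides the height by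
        \<open>(norm w)^2\<close>, which is at most \<open>1 / 2\<close>.\<close>
      ultimately have nw: "(norm w)\<^sup>2 \<le> 1 / 2" unfolding cmod_power2 by (simp add: power_divide)
      have w0: "w \<noteq> 0" using Imw zpos by auto
      define v where "v = - 1 / w"
      have Imv: "Im v = Im z / (norm w)\<^sup>2"
        by (simp add: v_def Im_divide cmod_power2 Imw)
      have "Im z / (1 / 2) \<le> Im z / (norm w)\<^sup>2"
        using nw w0 zpos by (intro divide_left_mono) auto
      hence "Im v \<ge> 1 / 2 / 2 ^ k" unfolding Imv using Suc.prems by simp
      hence "(Im v) ^ 6 * norm (discriminant v) \<le> C" by (rule Suc.IH)
      also have "discriminant v = w ^ 12 * discriminant w"
        unfolding v_def by (rule discriminant_inversion) (simp add: Imw zpos)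
      also have "discriminant w = discriminant z" by (simp add: w_def discriminant_minus_of_int)
      also have "(Im v) ^ 6 * norm (w ^ 12 * discriminant z) = (Im z) ^ 6 * norm (discriminant z)"
        unfolding Imv using w0 by (simp add: norm_mult norm_power power_divide flip: power_mult)
      finally show ?thesis .
    qed
  qed
  show ?thesis
  proof (rule that[OF C(1)])
    fix z :: complex assume z: "Im z > 0"
    obtain k :: nat where "1 / (2 * Im z) < 2 ^ k" using real_arch_pow[of 2 "1 / (2 * Im z)"] by auto
    hence "Im z \<ge> 1 / 2 / 2 ^ k" using z by (simp add: field_simps)
    thus "(Im z) ^ 6 * norm (discriminant z) \<le> C" by (rule main)
  qed
qed

section \<open>Mean square of the coefficients by Parseval\<close>

text \<open>Orthogonality of the characters of the cyclic group of order \<open>L\<close>; sampling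
  at roots of unity replaces the integral over the circle.\<close>

lemma discrete_parseval:
  fixes c :: "nat \<Rightarrow> complex" and L :: nat
  assumes L: "L > 0"
  defines "u \<equiv> \<lambda>j. exp (2 * of_real pi * \<i> * of_nat j / of_nat L)"
  shows "(\<Sum>j<L. (norm (\<Sum>n<L. c n * u j ^ n))\<^sup>2) = real L * (\<Sum>n<L. (norm (c n))\<^sup>2)"
proof -
  \<comment> \<open>This symmetry turns the sum over sample points into a geometric sum in
    \<open>u n * cnj (u m)\<close>.\<close>
  have sw: "u j ^ n = u n ^ j" for j n
    unfolding u_def by (simp add: mult_ac flip: exp_of_nat_mult)
  have sw': "cnj (u j) ^ n = cnj (u n) ^ j" for j n
    using sw[of j n] by (simp flip: complex_cnj_power)
  have nu: "norm (u n) = 1" for n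
    unfolding u_def by simp
  have uL: "u n ^ L = 1" for n
  proof -
    have "u n ^ L = exp (of_nat L * (2 * of_real pi * \<i> * of_nat n / of_nat L))"
      unfolding u_def by (rule exp_of_nat_mult[symmetric])
    also have "of_nat L * (2 * of_real pi * \<i> * of_nat n / of_nat L) = of_nat n * (2 * of_real pi * \<i>)"
      using L by simp
    also have "exp (of_nat n * (2 * of_real pi * \<i>)) = exp (2 * of_real pi * \<i>) ^ n"
      by (rule exp_of_nat_mult)
    finally show ?thesis by (simp only: exp_two_pi_i power_one)
  qed
  have orth: "(\<Sum>j<L. (u n * cnj (u m)) ^ j) = (if n = m then of_nat L else 0)" if "n < L" "m < L" for n m
  proof (cases "n = m")
    case True
    thus ?thesis using complex_norm_square[of "u m"] nu[of m] by simp
  next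
    case False
    have "u n \<noteq> u m"
      unfolding u_def using complex_root_unity_eq[of L n m] False that L by simp
    have cm: "cnj (u m) * u m = 1" using complex_norm_square[of "u m"] nu[of m] by (simp add: mult.commute)
    have ne: "u n * cnj (u m) \<noteq> 1"
    proof
      assume "u n * cnj (u m) = 1"
      hence "u n * (cnj (u m) * u m) = u m" by (metis mult.assoc mult_1)
      with cm \<open>u n \<noteq> u m\<close> show False by simp
    qed
    have "(u n * cnj (u m)) ^ L = 1"
      by (simp add: power_mult_distrib uL flip: complex_cnj_power)
    thus ?thesis using ne False by (simp add: geometric_sum)
  qed
  have "complex_of_real (\<Sum>j<L. (norm (\<Sum>n<L. c n * u j ^ n))\<^sup>2)
     = (\<Sum>j<L. (\<Sum>n<L. c n * u j ^ n) * cnj (\<Sum>n<L. c n * u j ^ n))"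
    by (simp only: of_real_sum complex_norm_square)
  also have "\<dots> = (\<Sum>j<L. \<Sum>n<L. \<Sum>m<L. c n * cnj (c m) * (u n * cnj (u m)) ^ j)"
    unfolding cnj_sum sum_product
    by (intro sum.cong refl) (simp only: complex_cnj_mult complex_cnj_power power_mult_distrib, subst sw, subst sw', simp only: mult_ac)
  also have "\<dots> = (\<Sum>n<L. \<Sum>j<L. \<Sum>m<L. c n * cnj (c m) * (u n * cnj (u m)) ^ j)"
    by (rule sum.swap)
  also have "\<dots> = (\<Sum>n<L. \<Sum>m<L. \<Sum>j<L. c n * cnj (c m) * (u n * cnj (u m)) ^ j)"
    by (intro sum.cong refl sum.swap)
  also have "\<dots> = (\<Sum>n<L. \<Sum>m<L. if n = m then of_nat L * (c n * cnj (c m)) else 0)"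
    unfolding sum_distrib_left[symmetric] by (intro sum.cong refl) (use orth in auto)
  also have "\<dots> = (\<Sum>n<L. of_nat L * (c n * cnj (c n)))"
    by (intro sum.cong refl) (simp add: sum.delta)
  also have "\<dots> = complex_of_real (real L * (\<Sum>n<L. (norm (c n))\<^sup>2))"
    by (simp only: of_real_mult of_real_sum complex_norm_square of_real_of_nat_eq sum_distrib_left)
  finally show ?thesis by (simp only: of_real_eq_iff)
qed

text \<open>Discrete Parseval for the truncation at \<open>L\<close>, whose values at the roots of
  unity are at most \<open>B\<close> plus the tail \<open>T L\<close>; then \<open>L\<close> tends
  to infinity.\<close>

lemma power_series_coeff_l2_bound:
  fixes c :: "nat \<Rightarrow> complex"
  assumes c: "summable (\<lambda>n. norm (c n))"
    and B: "\<And>u. norm u = 1 \<Longrightarrow> norm (\<Sum>n. c n * u ^ n) \<le> B"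
  shows "(\<Sum>n<N. (norm (c n))\<^sup>2) \<le> B\<^sup>2"
proof -
  define T where "T L = (\<Sum>n. norm (c (n + L)))" for L
  have T: "T \<longlonglongrightarrow> 0"
    unfolding T_def using suminf_exist_split[OF _ c] by (intro LIMSEQ_I) auto
  have le: "(\<Sum>n<N. (norm (c n))\<^sup>2) \<le> (B + T L)\<^sup>2" if L: "L \<ge> N" "L > 0" for L
  proof -
    define u where "u j = exp (2 * of_real pi * \<i> * of_nat j / of_nat L)" for j
    have part: "norm (\<Sum>n<L. c n * u j ^ n) \<le> B + T L" for j
    proof -
      have nu: "norm (u j) = 1" unfolding u_def by simp
      have s: "summable (\<lambda>n. norm (c n * u j ^ n))"
        using c nu by (simp add: norm_mult norm_power)
      have "(\<Sum>n<L. c n * u j ^ n) = (\<Sum>n. c n * u j ^ n) - (\<Sum>n. c (n + L) * u j ^ (n + L))"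
        using suminf_minus_initial_segment[OF summable_norm_cancel[OF s], of L] by simp
      also have "norm \<dots> \<le> norm (\<Sum>n. c n * u j ^ n) + norm (\<Sum>n. c (n + L) * u j ^ (n + L))"
        by (rule norm_triangle_ineq4)
      also have "norm (\<Sum>n. c (n + L) * u j ^ (n + L)) \<le> T L"
        unfolding T_def by (rule norm_suminf_le) (use nu summable_ignore_initial_segment[OF c] in \<open>auto simp: norm_mult norm_power\<close>)
      finally show ?thesis using B[OF nu] by simp
    qed
    have "real L * (\<Sum>n<L. (norm (c n))\<^sup>2) = (\<Sum>j<L. (norm (\<Sum>n<L. c n * u j ^ n))\<^sup>2)"
      unfolding u_def by (rule discrete_parseval[symmetric]) fact
    also have "\<dots> \<le> (\<Sum>j<L. (B + T L)\<^sup>2)"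
      by (intro sum_mono power_mono part) auto
    finally have "(\<Sum>n<L. (norm (c n))\<^sup>2) \<le> (B + T L)\<^sup>2" using L by simp
    moreover have "(\<Sum>n<N. (norm (c n))\<^sup>2) \<le> (\<Sum>n<L. (norm (c n))\<^sup>2)"
      by (intro sum_mono2) (use L in auto)
    ultimately show ?thesis by linarith
  qed
  have "(\<lambda>L. (B + T L)\<^sup>2) \<longlonglongrightarrow> (B + 0)\<^sup>2" by (intro tendsto_intros T)
  hence "(\<Sum>n<N. (norm (c n))\<^sup>2) \<le> (B + 0)\<^sup>2"
    by (rule LIMSEQ_le_const) (use le in \<open>auto intro!: exI[of _ "Suc N"]\<close>)
  thus ?thesis by simp
qed

text \<open>At height \<open>1 / N\<close> the invariant bound reads
  \<open>norm (discriminant z) \<le> C N ^ 6\<close>. The damping \<open>\<rho> ^ n\<close> is at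
  least \<open>exp (- 2 pi)\<close> for \<open>n \<le> N\<close>, so removing it from the squares
  costs a factor \<open>exp (4 pi)\<close>.\<close>

lemma ramanujan_tau_mean_square:
  obtains C where "C > 0" "\<And>N. (\<Sum>n<N. (of_int (ramanujan_tau (Suc n)) :: real)\<^sup>2) \<le> C * real N ^ 12"
proof -
  obtain C where C: "C > 0" "\<And>z. Im z > 0 \<Longrightarrow> (Im z) ^ 6 * norm (discriminant z) \<le> C"
    using norm_discriminant_le by blast
  define K where "K = C\<^sup>2 * exp (4 * pi)"
  show ?thesis
  proof (rule that[of K])
    show "K > 0" using C(1) by (simp add: K_def)
    fix N :: nat
    show "(\<Sum>n<N. (of_int (ramanujan_tau (Suc n)) :: real)\<^sup>2) \<le> K * real N ^ 12"
    proof (cases "N = 0")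
      case False
      define \<rho> where "\<rho> = exp (- 2 * pi / real N)"
      have rho: "0 < \<rho>" "\<rho> < 1" using False by (auto simp: \<rho>_def)
      define c :: "nat \<Rightarrow> complex" where "c n = of_int (ramanujan_tau n) * of_real \<rho> ^ n" for n
      have nc: "norm (c n) = \<bar>of_int (ramanujan_tau n)\<bar> * \<rho> ^ n" for n
        using rho by (simp add: c_def norm_mult norm_power)
      have "(\<Sum>n<Suc N. (norm (c n))\<^sup>2) \<le> (C * real N ^ 6)\<^sup>2"
      proof (rule power_series_coeff_l2_bound)
        show "summable (\<lambda>n. norm (c n))"
          unfolding nc using rho by (intro summable_norm_ramanujan_tau_power) auto
        fix u :: complex assume u: "norm u = 1"
        define t where "t = Arg u"
        have t: "u = cis t" using cis_Arg[of u] u by (cases "u = 0") (auto simp: t_def sgn_div_norm)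
        \<comment> \<open>The point at height \<open>1 / N\<close> whose nome is
          \<open>\<rho> * u\<close>.\<close>
        define z where "z = Complex (t / (2 * pi)) (1 / real N)"
        have "exp (2 * of_real pi * \<i> * z) = of_real \<rho> * u"
        proof -
          have "2 * of_real pi * \<i> * z = of_real (- 2 * pi / real N) + \<i> * of_real t"
            by (simp add: z_def complex_eq_iff)
          thus ?thesis by (simp only: exp_add exp_of_real t cis_conv_exp \<rho>_def)
        qed
        hence "discriminant z = (\<Sum>n. of_int (ramanujan_tau n) * (of_real \<rho> * u) ^ n)"
          by (simp add: discriminant_def discriminant_disc_def)
        also have "\<dots> = (\<Sum>n. c n * u ^ n)" by (simp add: c_def power_mult_distrib mult.assoc)
        finally have "(1 / real N) ^ 6 * norm (\<Sum>n. c n * u ^ n) \<le> C"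
          using C(2)[of z] False by (simp add: z_def)
        thus "norm (\<Sum>n. c n * u ^ n) \<le> C * real N ^ 6"
          using False by (simp add: field_simps)
      qed
      hence "(\<Sum>n<N. (norm (c (Suc n)))\<^sup>2) \<le> (C * real N ^ 6)\<^sup>2"
        by (simp add: sum.lessThan_Suc_shift c_def del: sum.lessThan_Suc)
      moreover have "(\<Sum>n<N. (of_int (ramanujan_tau (Suc n)))\<^sup>2 * exp (- 4 * pi)) \<le> (\<Sum>n<N. (norm (c (Suc n)))\<^sup>2)"
      proof (rule sum_mono)
        fix n assume n: "n \<in> {..<N}"
        have "exp (- 4 * pi) = (\<rho> ^ N)\<^sup>2"
          using False by (simp add: \<rho>_def flip: exp_of_nat_mult exp_double)
        also have "\<dots> \<le> (\<rho> ^ Suc n)\<^sup>2"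
          using n rho by (intro power_mono power_decreasing) auto
        finally show "(of_int (ramanujan_tau (Suc n)))\<^sup>2 * exp (- 4 * pi) \<le> (norm (c (Suc n)))\<^sup>2"
          unfolding nc power_mult_distrib by (simp add: mult_left_mono)
      qed
      ultimately have "(\<Sum>n<N. (of_int (ramanujan_tau (Suc n)) :: real)\<^sup>2) * exp (- 4 * pi) \<le> (C * real N ^ 6)\<^sup>2"
        by (simp add: sum_distrib_right)
      also have "(C * real N ^ 6)\<^sup>2 = K * real N ^ 12 * exp (- 4 * pi)"
        by (simp add: K_def power_mult_distrib exp_minus flip: power_mult)
      finally show ?thesis by simp
    qed simp
  qed
qed

text \<open>Abel summation as an induction: the weighted sum dominates the plain sum times the last
  weight.\<close>

lemma sum_mult_decreasing_nonneg:
  fixes d w :: "nat \<Rightarrow> real"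
  assumes d: "\<And>N. (\<Sum>n<N. d n) \<ge> 0" and w: "\<And>n. w n \<ge> 0" "\<And>n. w (Suc n) \<le> w n"
  shows "(\<Sum>n<N. d n * w n) \<ge> 0"
proof -
  have *: "(\<Sum>n<Suc N. d n * w n) \<ge> (\<Sum>n<Suc N. d n) * w N" for N
  proof (induction N)
    case (Suc N)
    have "(\<Sum>n<Suc (Suc N). d n) * w (Suc N) = (\<Sum>n<Suc N. d n) * w (Suc N) + d (Suc N) * w (Suc N)"
      by (simp add: algebra_simps)
    also have "(\<Sum>n<Suc N. d n) * w (Suc N) \<le> (\<Sum>n<Suc N. d n) * w N"
      by (intro mult_left_mono d w)
    finally show ?case using Suc by simp
  qed simp
  show ?thesis
  proof (cases N)
    case (Suc M)
    have "(\<Sum>n<Suc M. d n) * w M \<ge> 0" by (intro mult_nonneg_nonneg d w)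
    thus ?thesis unfolding Suc using *[of M] by (rule order_trans)
  qed simp
qed

text \<open>The increments \<open>b n\<close> of \<open>C N ^ 12\<close> have partial sums at least
  as large as those of the squares, so by Abel summation they may replace the squares. They are of
  size \<open>n ^ 11\<close>, and \<open>11 - a < - 1\<close>.\<close>

lemma summable_ramanujan_tau_square:
  fixes a :: real
  assumes a: "a > 12"
  shows "summable (\<lambda>n. (of_int (ramanujan_tau (Suc n)))\<^sup>2 * real (Suc n) powr (- a))"
proof -
  obtain C where C: "C > 0" "\<And>N. (\<Sum>n<N. (of_int (ramanujan_tau (Suc n)) :: real)\<^sup>2) \<le> C * real N ^ 12"
    using ramanujan_tau_mean_square by blast
  define t where "t n = (of_int (ramanujan_tau (Suc n)) :: real)\<^sup>2" for n
  define w where "w n = real (Suc n) powr (- a)" for n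
  define b where "b n = C * (real (Suc n) ^ 12 - real n ^ 12)" for n
  have bsum: "(\<Sum>n<N. b n) = C * real N ^ 12" for N
    by (induction N) (simp_all add: b_def algebra_simps)
  have le: "(\<Sum>n<N. t n * w n) \<le> (\<Sum>n<N. b n * w n)" for N
  proof -
    have "(\<Sum>n<N. (b n - t n) * w n) \<ge> 0"
    proof (rule sum_mult_decreasing_nonneg)
      show "(\<Sum>n<N. b n - t n) \<ge> 0" for N
        using C(2)[of N] by (simp add: sum_subtractf bsum t_def)
      show "w (Suc n) \<le> w n" for n unfolding w_def using a by (intro powr_mono2') auto
    qed (simp add: w_def)
    thus ?thesis by (simp add: left_diff_distrib sum_subtractf)
  qed
  have bw: "b n * w n \<le> 12 * C * real (Suc n) powr (11 - a)" for n
  proof -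
    have "real (Suc n) ^ 12 - real n ^ 12 = (real (Suc n) - real n) * (\<Sum>p<12::nat. real (Suc n) ^ p * real n ^ (11 - p))"
      using diff_power_eq_sum[of "real (Suc n)" 11 "real n"] by simp
    also have "\<dots> \<le> (\<Sum>p<12::nat. real (Suc n) ^ 11)"
    proof -
      have "(\<Sum>p<12::nat. real (Suc n) ^ p * real n ^ (11 - p)) \<le> (\<Sum>p<12::nat. real (Suc n) ^ 11)"
      proof (rule sum_mono)
        fix p :: nat assume p: "p \<in> {..<12}"
        have "real (Suc n) ^ p * real n ^ (11 - p) \<le> real (Suc n) ^ p * real (Suc n) ^ (11 - p)"
          by (intro mult_left_mono power_mono) auto
        also have "\<dots> = real (Suc n) ^ 11" using p by (simp flip: power_add)
        finally show "real (Suc n) ^ p * real n ^ (11 - p) \<le> real (Suc n) ^ 11" .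
      qed
      thus ?thesis by simp
    qed
    also have "\<dots> = 12 * real (Suc n) ^ 11" by simp
    finally have "b n \<le> C * (12 * real (Suc n) ^ 11)" unfolding b_def using C(1) by (intro mult_left_mono) auto
    hence "b n * w n \<le> C * (12 * real (Suc n) ^ 11) * w n" by (intro mult_right_mono) (auto simp: w_def)
    also have "\<dots> = 12 * C * (real (Suc n) powr 11 * real (Suc n) powr (- a))"
      using powr_realpow[of "real (Suc n)" 11] by (simp add: w_def del: of_nat_Suc)
    also have "real (Suc n) powr 11 * real (Suc n) powr (- a) = real (Suc n) powr (11 - a)"
      by (simp only: powr_add[symmetric]) simp
    finally show ?thesis .
  qed
  have "summable (\<lambda>n. real n powr (11 - a))" using a by (subst summable_real_powr_iff) auto
  hence sp: "summable (\<lambda>n. 12 * C * real (Suc n) powr (11 - a))"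
    by (intro summable_mult) (subst summable_Suc_iff)
  show ?thesis
  proof (rule summableI_nonneg_bounded)
    fix N
    have "(\<Sum>n<N. t n * w n) \<le> (\<Sum>n<N. 12 * C * real (Suc n) powr (11 - a))"
      by (rule order_trans[OF le sum_mono]) (rule bw)
    also have "\<dots> \<le> (\<Sum>n. 12 * C * real (Suc n) powr (11 - a))"
      by (rule sum_le_suminf[OF sp]) (use C in auto)
    finally show "(\<Sum>n<N. (of_int (ramanujan_tau (Suc n)))\<^sup>2 * real (Suc n) powr (- a)) \<le> (\<Sum>n. 12 * C * real (Suc n) powr (11 - a))"
      by (simp add: t_def w_def)
  qed simp
qed

text \<open>Cauchy-Schwarz in the pointwise form \<open>x y \<le> x^2 + y^2\<close>. The split
  \<open>a = s + 11 / 2\<close> makes both requirements, \<open>a > 12\<close> and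
  \<open>a - 2 s < - 1\<close>, equivalent to \<open>s > 13 / 2\<close>.\<close>

lemma summable_abs_ramanujan_tau:
  fixes s :: real
  assumes s: "s > 13 / 2"
  shows "summable (\<lambda>n. \<bar>of_int (ramanujan_tau (Suc n))\<bar> * real (Suc n) powr (- s))"
proof -
  define a where "a = s + 11 / 2"
  have "summable (\<lambda>n. real n powr (a - 2 * s))" using s by (subst summable_real_powr_iff) (auto simp: a_def)
  hence s1: "summable (\<lambda>n. real (Suc n) powr (a - 2 * s))" by (subst summable_Suc_iff)
  have s2: "summable (\<lambda>n. (of_int (ramanujan_tau (Suc n)))\<^sup>2 * real (Suc n) powr (- a))"
    using s by (intro summable_ramanujan_tau_square) (auto simp: a_def)
  show ?thesis
  proof (rule summable_comparison_test'[OF summable_add[OF s2 s1], of 0])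
    fix n
    define x where "x = \<bar>of_int (ramanujan_tau (Suc n))\<bar> * real (Suc n) powr (- a / 2)"
    define y where "y = real (Suc n) powr (a / 2 - s)"
    have xy: "\<bar>of_int (ramanujan_tau (Suc n))\<bar> * real (Suc n) powr (- s) = x * y"
      by (simp add: x_def y_def mult.assoc powr_add[symmetric] del: of_nat_Suc)
    have x2: "x\<^sup>2 = (of_int (ramanujan_tau (Suc n)))\<^sup>2 * real (Suc n) powr (- a)"
      by (simp add: x_def power_mult_distrib power2_eq_square powr_add[symmetric] mult_ac del: of_nat_Suc)
    have y2: "y\<^sup>2 = real (Suc n) powr (a - 2 * s)"
      by (simp add: y_def power2_eq_square powr_add[symmetric] del: of_nat_Suc)
    have "x \<ge> 0" "y \<ge> 0" by (simp_all add: x_def y_def)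
    hence "x * y \<le> x\<^sup>2 + y\<^sup>2"
      using sum_squares_bound[of x y] mult_nonneg_nonneg[of x y] unfolding mult.assoc by linarith
    thus "norm (\<bar>of_int (ramanujan_tau (Suc n))\<bar> * real (Suc n) powr (- s))
        \<le> (of_int (ramanujan_tau (Suc n)))\<^sup>2 * real (Suc n) powr (- a) + real (Suc n) powr (a - 2 * s)"
      unfolding xy x2[symmetric] y2[symmetric] using \<open>x \<ge> 0\<close> \<open>y \<ge> 0\<close> by simp
  qed
qed

section \<open>The entire function as a Fourier-Laplace integral\<close>

text \<open>Substitution \<open>u = c exp t\<close> in Euler's integral for \<open>Gamma\<close>;
  Borel measurability then carries integrability from Lebesgue measure to
  \<open>lborel\<close>.\<close>

lemma
  fixes s :: complex and c :: real
  assumes c: "c > 0" and s: "Re s > 0"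
  shows integrable_mellin_exp: "integrable lborel (\<lambda>t. exp (s * of_real t) * of_real (exp (- c * exp t)))"
    and integral_mellin_exp:
      "(LINT t|lborel. exp (s * of_real t) * of_real (exp (- c * exp t))) = of_real c powr (- s) * Gamma s"
proof -
  define f where "f u = complex_of_real u powr (s - 1) / of_real (exp u)" for u :: real
  define h where "h t = exp (s * of_real t) * complex_of_real (exp (- c * exp t))" for t :: real
  have img: "(\<lambda>t. c * exp t) ` UNIV = {0<..}"
  proof safe
    fix x :: real assume "x > 0"
    hence "x = c * exp (ln (x / c))" using c by simp
    thus "x \<in> range (\<lambda>t. c * exp t)" by blast
  qed (use c in auto)
  have "f absolutely_integrable_on {0<..}" "integral {0<..} f = Gamma s"
    unfolding f_def using absolutely_integrable_Gamma_integral'[OF s] integral_unique[OF Gamma_integral_complex'[OF s]] by auto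
  hence *: "(\<lambda>t. \<bar>c * exp t\<bar> *\<^sub>R f (c * exp t)) absolutely_integrable_on UNIV \<and>
            integral UNIV (\<lambda>t. \<bar>c * exp t\<bar> *\<^sub>R f (c * exp t)) = Gamma s"
    using c img by (subst has_absolute_integral_change_of_variables_real)
      (auto intro!: derivative_eq_intros inj_onI)
  have eq: "\<bar>c * exp t\<bar> *\<^sub>R f (c * exp t) = of_real c powr s * h t" for t
  proof -
    define l where "l = complex_of_real (ln c)"
    have ce: "complex_of_real (c * exp t) = exp (l + of_real t)"
      using c by (simp add: l_def exp_add exp_of_real)
    have "Ln (complex_of_real (c * exp t)) = l + of_real t"
      using c by (subst Ln_of_real) (auto simp: ln_mult l_def)
    hence p: "complex_of_real (c * exp t) powr (s - 1) = exp ((s - 1) * (l + of_real t))"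
      using c by (simp add: powr_def)
    have "\<bar>c * exp t\<bar> *\<^sub>R f (c * exp t) = complex_of_real (c * exp t) * complex_of_real (c * exp t) powr (s - 1) * of_real (exp (- c * exp t))"
      unfolding f_def using c by (simp add: scaleR_conv_of_real exp_minus divide_inverse)
    also have "\<dots> = exp (s * l) * h t"
      unfolding p unfolding ce h_def mult.assoc[symmetric] exp_add[symmetric] by (simp add: algebra_simps)
    also have "exp (s * l) = of_real c powr s"
      using c by (simp add: powr_def l_def Ln_of_real)
    finally show ?thesis .
  qed
  have nz: "complex_of_real c powr s \<noteq> 0" using c by (simp add: powr_def)
  have "(\<lambda>t. of_real c powr (- s) * (of_real c powr s * h t)) absolutely_integrable_on UNIV"
    using * unfolding eq by (intro set_integrable_mult_right) auto
  hence "h absolutely_integrable_on UNIV" using nz by (simp add: powr_minus field_simps)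
  hence "integrable lebesgue h" by (simp add: set_integrable_def)
  moreover have hm: "h \<in> borel_measurable lborel"
    unfolding h_def measurable_lborel2 by (intro borel_measurable_continuous_onI continuous_intros)
  ultimately have int: "integrable lborel h" by (simp add: integrable_completion)
  thus "integrable lborel (\<lambda>t. exp (s * of_real t) * of_real (exp (- c * exp t)))"
    by (simp add: h_def[abs_def])
  have "of_real c powr s * integral UNIV h = Gamma s"
    using * unfolding eq by simp
  hence "integral UNIV h = of_real c powr (- s) * Gamma s"
    using nz by (simp add: powr_minus field_simps)
  thus "(LINT t|lborel. exp (s * of_real t) * of_real (exp (- c * exp t))) = of_real c powr (- s) * Gamma s"
    using integral_lborel[OF int] by (simp add: h_def[abs_def])
qed

lemma
  fixes s c :: real
  assumes c: "c > 0" and s: "s > 0"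
  shows integrable_mellin_exp_real: "integrable lborel (\<lambda>t. exp (s * t) * exp (- c * exp t))"
    and integral_mellin_exp_real: "(LINT t|lborel. exp (s * t) * exp (- c * exp t)) = c powr (- s) * Gamma s"
proof -
  have e: "exp (complex_of_real s * of_real t) * of_real (exp (- c * exp t)) = of_real (exp (s * t) * exp (- c * exp t))" for t
    by (simp add: exp_of_real flip: of_real_mult)
  show i: "integrable lborel (\<lambda>t. exp (s * t) * exp (- c * exp t))"
    using integrable_mellin_exp[OF c, of "of_real s"] s unfolding e by (simp only: complex_of_real_integrable_eq) simp
  have "complex_of_real (LINT t|lborel. exp (s * t) * exp (- c * exp t)) = of_real c powr (- of_real s) * Gamma (of_real s)"
    using integral_mellin_exp[OF c, of "of_real s"] s unfolding e integral_complex_of_real by simp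
  also have "\<dots> = of_real (c powr (- s) * Gamma s)"
    using c powr_of_real[of c "- s"] by (simp add: Gamma_complex_of_real)
  finally show "(LINT t|lborel. exp (s * t) * exp (- c * exp t)) = c powr (- s) * Gamma s"
    by (simp only: of_real_eq_iff)
qed

section \<open>The even, positive, rapidly decaying kernel\<close>

text \<open>Taking the real part loses nothing: \<open>discriminant\<close> is real on the imaginary
  axis.\<close>

definition xi_kernel :: "real \<Rightarrow> real" where
  "xi_kernel t = exp (6 * t) * Re (discriminant (\<i> * of_real (exp t)))"

lemma discriminant_axis:
  assumes "y > 0"
  shows "discriminant (\<i> * of_real y) = of_real (Re (discriminant (\<i> * of_real y)))"
    and "Re (discriminant (\<i> * of_real y)) > 0"
    and "Re (discriminant (\<i> * of_real y)) \<le> exp (- 2 * pi * y)"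
proof -
  have r: "0 < exp (- 2 * pi * y)" "exp (- 2 * pi * y) < 1" using assms by auto
  note eq = discriminant_imaginary_axis[OF assms]
  show "discriminant (\<i> * of_real y) = of_real (Re (discriminant (\<i> * of_real y)))"
       "Re (discriminant (\<i> * of_real y)) > 0"
    unfolding eq by (simp_all only: Re_complex_of_real exp_gt_zero)
  have "ln (1 - exp (- 2 * pi * y) ^ Suc n) \<le> 0" for n
  proof -
    have "exp (- 2 * pi * y) ^ Suc n < 1" using r power_Suc_less_one by blast
    moreover have "exp (- 2 * pi * y) ^ Suc n > 0" by (rule zero_less_power) simp
    ultimately show ?thesis by (simp del: power_Suc)
  qed
  hence "(\<Sum>n. ln (1 - exp (- 2 * pi * y) ^ Suc n)) \<le> 0"
    by (intro suminf_le_const summable_ln_one_minus_power r sum_nonpos)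
  thus "Re (discriminant (\<i> * of_real y)) \<le> exp (- 2 * pi * y)"
    unfolding eq by (simp only: Re_complex_of_real exp_le_cancel_iff)
qed

lemma of_real_xi_kernel:
  "complex_of_real (xi_kernel t) = exp (6 * of_real t) * discriminant (\<i> * of_real (exp t))"
proof -
  have "complex_of_real (xi_kernel t) = of_real (exp (6 * t)) * of_real (Re (discriminant (\<i> * of_real (exp t))))"
    by (simp only: xi_kernel_def of_real_mult)
  also have "complex_of_real (Re (discriminant (\<i> * of_real (exp t)))) = discriminant (\<i> * of_real (exp t))"
    by (rule discriminant_axis(1)[symmetric]) simp
  also have "complex_of_real (exp (6 * t)) = exp (6 * of_real t)"
    by (simp flip: exp_of_real)
  finally show ?thesis .
qed

lemma xi_kernel_pos: "xi_kernel t > 0"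
  unfolding xi_kernel_def by (intro mult_pos_pos discriminant_axis) auto

text \<open>The factor \<open>exp (6 * t)\<close> is the square root of the weight factor
  \<open>y ^ 12\<close> at \<open>y = exp t\<close>, which turns the inversion formula into a
  symmetry.\<close>

lemma xi_kernel_even: "xi_kernel (- t) = xi_kernel t"
proof -
  define y where "y = exp t"
  have y: "y > 0" by (simp add: y_def)
  have "- 1 / (\<i> * of_real y) = \<i> * of_real (1 / y)"
    using y by (simp add: complex_eq_iff Re_divide Im_divide power2_eq_square)
  moreover have "(\<i> * complex_of_real y) ^ 12 = of_real y ^ 12"
  proof -
    have "\<i> ^ 12 = (\<i>\<^sup>2) ^ 6" by (simp only: power_mult[symmetric]) simp
    hence "\<i> ^ 12 = 1" by simp
    thus ?thesis unfolding power_mult_distrib by simp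
  qed
  ultimately have "discriminant (\<i> * of_real (1 / y)) = of_real y ^ 12 * discriminant (\<i> * of_real y)"
    using discriminant_inversion[of "\<i> * of_real y"] y by simp
  moreover have "exp (- t) = 1 / y" by (simp add: y_def exp_minus field_simps)
  ultimately have "complex_of_real (xi_kernel (- t)) = exp (- 6 * of_real t) * (of_real y ^ 12 * discriminant (\<i> * of_real y))"
    unfolding of_real_xi_kernel by simp
  also have "complex_of_real y ^ 12 = exp (12 * of_real t)"
    using exp_of_nat_mult[of 12 "complex_of_real t"] by (simp add: y_def exp_of_real)
  also have "exp (- 6 * of_real t) * (exp (12 * of_real t) * discriminant (\<i> * of_real y)) = complex_of_real (xi_kernel t)"
    unfolding of_real_xi_kernel y_def mult.assoc[symmetric] exp_add[symmetric] by simp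
  finally show ?thesis by (simp only: of_real_eq_iff)
qed

lemma continuous_xi_kernel: "continuous_on A xi_kernel"
proof -
  have "continuous_on A (discriminant \<circ> (\<lambda>t. \<i> * of_real (exp t)))"
    by (intro continuous_on_compose continuous_intros
          continuous_on_subset[OF holomorphic_on_imp_continuous_on[OF holomorphic_discriminant]]) auto
  thus ?thesis unfolding xi_kernel_def o_def by (intro continuous_intros)
qed

lemma borel_measurable_xi_kernel [measurable]: "xi_kernel \<in> borel_measurable borel"
  by (intro borel_measurable_continuous_onI continuous_xi_kernel)

text \<open>One majorant for all exponential weights at once. By evenness only
  \<open>u = |t|\<close> matters, and there the decay \<open>exp (- 2 pi exp u)\<close> absorbs
  \<open>exp (exp u)\<close>, since \<open>2 pi - 1 \<ge> 1\<close>.\<close>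

lemma integrable_xi_kernel_exp_exp: "integrable lborel (\<lambda>t. xi_kernel t * exp (exp \<bar>t\<bar>))"
proof -
  define G where "G t = exp (6 * t) * exp (- 1 * exp t)" for t :: real
  have G: "integrable lborel G"
    unfolding G_def by (intro integrable_mellin_exp_real) auto
  have G': "integrable lborel (\<lambda>t. G (- t))"
    using lborel_integrable_real_affine[OF G, of "-1" 0] by simp
  have le: "xi_kernel t * exp (exp \<bar>t\<bar>) \<le> G t + G (- t)" for t
  proof -
    define u where "u = \<bar>t\<bar>"
    have ku: "xi_kernel t = xi_kernel u" by (auto simp: u_def xi_kernel_even abs_if)
    have "xi_kernel u \<le> exp (6 * u) * exp (- 2 * pi * exp u)"
      unfolding xi_kernel_def by (intro mult_left_mono discriminant_axis) auto
    hence "xi_kernel u * exp (exp u) \<le> exp (6 * u) * exp (- 2 * pi * exp u) * exp (exp u)"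
      by (intro mult_right_mono) auto
    also have "\<dots> = exp (6 * u) * exp (- 2 * pi * exp u + exp u)"
      by (simp only: exp_add mult.assoc)
    also have "\<dots> \<le> exp (6 * u) * exp (- 1 * exp u)"
    proof -
      have "2 * exp u \<le> 2 * pi * exp u" using pi_gt3 by (intro mult_right_mono) auto
      thus ?thesis by simp
    qed
    also have "\<dots> = G u" by (simp add: G_def)
    also have "\<dots> \<le> G t + G (- t)" by (cases "t \<ge> 0") (auto simp: u_def G_def)
    finally show ?thesis using ku by (simp add: u_def)
  qed
  show ?thesis
  proof (rule Bochner_Integration.integrable_bound[OF Bochner_Integration.integrable_add[OF G G']])
    show "AE t in lborel. norm (xi_kernel t * exp (exp \<bar>t\<bar>)) \<le> norm (G t + G (- t))"
    proof (rule AE_I2)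
      fix t
      have "xi_kernel t * exp (exp \<bar>t\<bar>) \<ge> 0" using xi_kernel_pos[of t] by simp
      thus "norm (xi_kernel t * exp (exp \<bar>t\<bar>)) \<le> norm (G t + G (- t))" using le[of t] by simp
    qed
  qed simp
qed

text \<open>The tangent to exp at \<open>ln r\<close> lies below the graph, which gives
  \<open>r |t| \<le> r ln r + exp |t|\<close>.\<close>

lemma xi_kernel_exp_le:
  assumes "r > 0"
  shows "xi_kernel t * exp (r * \<bar>t\<bar>) \<le> exp (r * ln r) * (xi_kernel t * exp (exp \<bar>t\<bar>))"
proof -
  have "1 + (\<bar>t\<bar> - ln r) \<le> exp (\<bar>t\<bar> - ln r)" by (rule exp_ge_add_one_self)
  hence "r * (1 + (\<bar>t\<bar> - ln r)) \<le> r * exp (\<bar>t\<bar> - ln r)" using assms by simp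
  also have "\<dots> = exp \<bar>t\<bar>" using assms by (simp add: exp_diff)
  finally have "r * \<bar>t\<bar> \<le> r * ln r + exp \<bar>t\<bar>" using assms by (simp add: algebra_simps)
  hence "exp (r * \<bar>t\<bar>) \<le> exp (r * ln r) * exp (exp \<bar>t\<bar>)" by (simp flip: exp_add)
  thus ?thesis using xi_kernel_pos[of t] by (simp add: mult_left_mono mult.left_commute)
qed

lemma integrable_xi_kernel_exp_abs: "integrable lborel (\<lambda>t. xi_kernel t * exp (r * \<bar>t\<bar>))"
proof -
  \<comment> \<open>\<open>r\<close> is arbitrary here, whereas \<open>xi_kernel_exp_le\<close>
    needs a positive exponent.\<close>
  define R where "R = max r 1"
  show ?thesis
  proof (rule Bochner_Integration.integrable_bound[OF integrable_mult_right[OF integrable_xi_kernel_exp_exp, of "exp (R * ln R)"]])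
    show "AE t in lborel. norm (xi_kernel t * exp (r * \<bar>t\<bar>)) \<le> norm (exp (R * ln R) * (xi_kernel t * exp (exp \<bar>t\<bar>)))"
    proof (rule AE_I2)
      fix t
      have "xi_kernel t * exp (r * \<bar>t\<bar>) \<le> xi_kernel t * exp (R * \<bar>t\<bar>)"
        using xi_kernel_pos[of t] by (intro mult_left_mono) (auto simp: R_def intro: mult_right_mono)
      also have "\<dots> \<le> exp (R * ln R) * (xi_kernel t * exp (exp \<bar>t\<bar>))"
        by (intro xi_kernel_exp_le) (simp add: R_def)
      finally show "norm (xi_kernel t * exp (r * \<bar>t\<bar>)) \<le> norm (exp (R * ln R) * (xi_kernel t * exp (exp \<bar>t\<bar>)))"
        using xi_kernel_pos[of t] by simp
    qed
  qed simp
qed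

lemma integral_xi_kernel_exp_abs_le:
  assumes "r > 0"
  shows "(LINT t|lborel. xi_kernel t * exp (r * \<bar>t\<bar>)) \<le> exp (r * ln r) * (LINT t|lborel. xi_kernel t * exp (exp \<bar>t\<bar>))"
proof -
  have "(LINT t|lborel. xi_kernel t * exp (r * \<bar>t\<bar>)) \<le> (LINT t|lborel. exp (r * ln r) * (xi_kernel t * exp (exp \<bar>t\<bar>)))"
    by (intro integral_mono integrable_xi_kernel_exp_abs integrable_mult_right integrable_xi_kernel_exp_exp xi_kernel_exp_le assms)
  thus ?thesis by simp
qed

section \<open>The transform of the kernel as an entire function\<close>

definition xi_transform :: "complex \<Rightarrow> complex" where
  "xi_transform z = (LINT t|lborel. of_real (xi_kernel t) * exp (z * of_real t))"

lemma norm_exp_mult_le: "norm (exp (z * complex_of_real t)) \<le> exp (norm z * \<bar>t\<bar>)"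
  using norm_exp[of "z * complex_of_real t"] by (simp add: norm_mult)

lemma norm_xi_transform_le: "norm (xi_transform z) \<le> (LINT t|lborel. xi_kernel t * exp (norm z * \<bar>t\<bar>))"
  unfolding xi_transform_def
proof (rule Bochner_Integration.integral_norm_bound_integral[OF _ integrable_xi_kernel_exp_abs])
  have b: "norm (of_real (xi_kernel t) * exp (z * of_real t)) \<le> xi_kernel t * exp (norm z * \<bar>t\<bar>)" for t
    using xi_kernel_pos[of t] norm_exp_mult_le[of z t] by (simp only: norm_mult norm_of_real abs_of_pos) (simp add: mult_left_mono)
  thus "norm (of_real (xi_kernel t) * exp (z * of_real t)) \<le> xi_kernel t * exp (norm z * \<bar>t\<bar>)" for t .
  show "integrable lborel (\<lambda>t. of_real (xi_kernel t) * exp (z * of_real t))"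
  proof (rule Bochner_Integration.integrable_bound[OF integrable_xi_kernel_exp_abs[of "norm z"]])
    show "AE t in lborel. norm (of_real (xi_kernel t) * exp (z * of_real t)) \<le> norm (xi_kernel t * exp (norm z * \<bar>t\<bar>))"
      unfolding real_norm_def by (intro AE_I2 order_trans[OF b abs_ge_self])
  qed simp
qed

lemma xi_transform_even: "xi_transform (- z) = xi_transform z"
  unfolding xi_transform_def
  by (subst lborel_integral_real_affine[of "-1" _ 0]) (simp_all add: xi_kernel_even)

text \<open>Termwise integration of the exponential series, dominated by the kernel times
  \<open>exp (|z| |t|)\<close>. The resulting everywhere convergent power series yields holomorphy
  without differentiating under the integral.\<close>

lemma xi_transform_sums:
  "(\<lambda>n. (LINT t|lborel. of_real (xi_kernel t * t ^ n / fact n)) * z ^ n) sums xi_transform z"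
proof -
  define f where "f n t = complex_of_real (xi_kernel t) * ((z * of_real t) ^ n /\<^sub>R fact n)" for n t
  define F where "F t = xi_kernel t * exp (norm z * \<bar>t\<bar>)" for t
  have F: "integrable lborel F" unfolding F_def by (rule integrable_xi_kernel_exp_abs)
  have nf: "norm (f n t) = xi_kernel t * ((norm z * \<bar>t\<bar>) ^ n /\<^sub>R fact n)" for n t
    using xi_kernel_pos[of t] by (simp add: f_def norm_mult norm_power power_mult_distrib)
  have ns: "(\<lambda>n. norm (f n t)) sums F t" for t
    unfolding nf F_def by (intro sums_mult exp_converges)
  have part: "(\<Sum>n<N. norm (f n t)) \<le> F t" for N t
    using ns[of t] by (metis norm_ge_zero sum_le_suminf sums_iff finite_lessThan)
  have le: "norm (f n t) \<le> F t" for n t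
    using part[of t "Suc n"] sum_nonneg[of "{..<n}" "\<lambda>n. norm (f n t)"] by simp
  have int: "integrable lborel (f n)" for n
  proof (rule Bochner_Integration.integrable_bound[OF F])
    show "AE t in lborel. norm (f n t) \<le> norm (F t)"
      unfolding real_norm_def by (intro AE_I2 order_trans[OF le abs_ge_self])
  qed (simp add: f_def[abs_def])
  have fs: "f n t = of_real (xi_kernel t * t ^ n / fact n) * z ^ n" for n t
    by (simp add: f_def power_mult_distrib scaleR_conv_of_real field_simps)
  have "(\<lambda>n. integral\<^sup>L lborel (f n)) sums (LINT t|lborel. (\<Sum>n. f n t))"
  proof (rule sums_integral[OF int])
    show "AE t in lborel. summable (\<lambda>n. norm (f n t))" using ns sums_summable by (intro AE_I2) blast
    show "summable (\<lambda>n. LINT t|lborel. norm (f n t))"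
    proof (rule summableI_nonneg_bounded)
      fix N
      have "(\<Sum>n<N. LINT t|lborel. norm (f n t)) = (LINT t|lborel. (\<Sum>n<N. norm (f n t)))"
        by (intro Bochner_Integration.integral_sum[symmetric] integrable_norm int)
      also have "\<dots> \<le> integral\<^sup>L lborel F"
        by (intro integral_mono F part Bochner_Integration.integrable_sum integrable_norm int)
      finally show "(\<Sum>n<N. LINT t|lborel. norm (f n t)) \<le> integral\<^sup>L lborel F" .
    qed simp
  qed
  also have "(\<lambda>n. integral\<^sup>L lborel (f n)) = (\<lambda>n. (LINT t|lborel. of_real (xi_kernel t * t ^ n / fact n)) * z ^ n)"
    unfolding fs by (simp only: integral_mult_left_zero)
  also have "(LINT t|lborel. (\<Sum>n. f n t)) = xi_transform z"
    unfolding xi_transform_def f_def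
    by (intro Bochner_Integration.integral_cong refl sums_unique[symmetric] sums_mult exp_converges)
  finally show ?thesis .
qed

lemma holomorphic_xi_transform: "xi_transform holomorphic_on A"
proof -
  have "xi_transform field_differentiable at z" for z
  proof -
    have "xi_transform holomorphic_on ball 0 (norm z + 1)"
      by (rule power_series_holomorphic[where a = "\<lambda>n. LINT t|lborel. of_real (xi_kernel t * t ^ n / fact n)"])
         (use xi_transform_sums in \<open>simp only: diff_zero\<close>)
    thus ?thesis by (rule holomorphic_on_imp_differentiable_at) auto
  qed
  thus ?thesis by (simp add: holomorphic_on_def field_differentiable_at_within)
qed

section \<open>Identification with the Ramanujan zeta function\<close>

text \<open>Termwise Mellin transformation; the interchange rests on
  \<open>summable_abs_ramanujan_tau\<close>. Dividing by \<open>Gamma\<close> through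
  \<open>rGamma\<close> gives an expression that is entire in \<open>s\<close>, as the continuation
  requires.\<close>

lemma ramanujan_dirichlet_series_sums:
  assumes s: "Re s > 13 / 2"
  shows "(\<lambda>k. of_int (ramanujan_tau (Suc k)) * of_nat (Suc k) powr (- s)) sums
           (of_real (2 * pi) powr s * rGamma s * xi_transform (s - 6))"
proof -
  define \<sigma> where "\<sigma> = Re s"
  have sg: "\<sigma> > 13 / 2" using s by (simp add: \<sigma>_def)
  define c where "c k = 2 * pi * real (Suc k)" for k
  have c: "c k > 0" for k unfolding c_def by simp
  define E where "E k t = exp (s * of_real t) * complex_of_real (exp (- c k * exp t))" for k and t :: real
  define f where "f k t = of_int (ramanujan_tau (Suc k)) * E k t" for k t
  have E: "integrable lborel (E k)" "integral\<^sup>L lborel (E k) = of_real (c k) powr (- s) * Gamma s" for k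
    unfolding E_def using integrable_mellin_exp[OF c] integral_mellin_exp[OF c] s by auto
  have nf: "norm (f k t) = \<bar>of_int (ramanujan_tau (Suc k))\<bar> * (exp (\<sigma> * t) * exp (- c k * exp t))" for k t
    by (simp add: f_def E_def norm_mult \<sigma>_def)
  have ek: "exp (- c k * exp t) = exp (- 2 * pi * exp t) ^ Suc k" for k t
    unfolding exp_of_nat_mult[symmetric] by (simp add: c_def algebra_simps)
  have qlt: "exp (- 2 * pi * exp t) < 1" for t :: real by simp
  have sm: "summable (\<lambda>k. norm (f k t))" for t
  proof -
    have "summable (\<lambda>k. \<bar>of_int (ramanujan_tau (Suc k))\<bar> * exp (- 2 * pi * exp t) ^ Suc k)"
      by (subst summable_Suc_iff) (intro summable_norm_ramanujan_tau_power, auto)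
    from summable_mult[OF this, of "exp (\<sigma> * t)"] show ?thesis
      unfolding nf ek by (simp add: mult_ac)
  qed
  have lim: "(\<lambda>k. f k t) sums (of_real (xi_kernel t) * exp ((s - 6) * of_real t))" for t
  proof -
    define q where "q = exp (2 * of_real pi * \<i> * (\<i> * complex_of_real (exp t)))"
    have q: "q = of_real (exp (- 2 * pi * exp t))"
      unfolding q_def exp_of_real[symmetric] by (rule arg_cong[where f = exp]) (simp add: complex_eq_iff Re_exp Im_exp)
    have "(\<lambda>m. of_int (ramanujan_tau m) * q ^ m) sums discriminant (\<i> * of_real (exp t))"
      unfolding discriminant_def q_def[symmetric] by (rule discriminant_disc_sums) (simp add: q)
    hence "(\<lambda>m. of_int (ramanujan_tau (Suc m)) * q ^ Suc m) sums discriminant (\<i> * of_real (exp t))"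
      by (subst sums_Suc_iff) simp
    moreover have "f k t = exp (s * of_real t) * (of_int (ramanujan_tau (Suc k)) * q ^ Suc k)" for k
      by (simp only: f_def E_def ek q of_real_power mult.left_commute)
    ultimately have "(\<lambda>k. f k t) sums (exp (s * of_real t) * discriminant (\<i> * of_real (exp t)))"
      by (simp only: sums_mult)
    \<comment> \<open>The shift from \<open>s\<close> to \<open>s - 6\<close> supplies the factor
      \<open>exp (6 * t)\<close> of \<open>xi_kernel\<close>.\<close>
    also have "exp (s * of_real t) = exp (6 * of_real t) * exp ((s - 6) * of_real t)"
      by (simp add: algebra_simps flip: exp_add)
    finally show ?thesis by (simp only: of_real_xi_kernel mult_ac)
  qed
  have cp: "c k powr (- \<sigma>) = (2 * pi) powr (- \<sigma>) * real (Suc k) powr (- \<sigma>)" for k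
    unfolding c_def by (rule powr_mult)
  have "(\<lambda>k. integral\<^sup>L lborel (f k)) sums (LINT t|lborel. (\<Sum>k. f k t))"
  proof (rule sums_integral)
    show "integrable lborel (f k)" for k unfolding f_def by (intro integrable_mult_right E)
    show "AE t in lborel. summable (\<lambda>k. norm (f k t))" using sm by simp
    have "(LINT t|lborel. norm (f k t)) = (2 * pi) powr (- \<sigma>) * Gamma \<sigma> * (\<bar>of_int (ramanujan_tau (Suc k))\<bar> * real (Suc k) powr (- \<sigma>))" for k
    proof -
      have "(LINT t|lborel. norm (f k t)) = \<bar>of_int (ramanujan_tau (Suc k))\<bar> * (LINT t|lborel. exp (\<sigma> * t) * exp (- c k * exp t))"
        unfolding nf by (rule integral_mult_right_zero)
      also have "(LINT t|lborel. exp (\<sigma> * t) * exp (- c k * exp t)) = c k powr (- \<sigma>) * Gamma \<sigma>"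
        by (rule integral_mellin_exp_real) (use c sg in auto)
      finally show ?thesis unfolding cp by (simp only: mult_ac)
    qed
    thus "summable (\<lambda>k. LINT t|lborel. norm (f k t))"
      by (simp only:) (intro summable_mult summable_abs_ramanujan_tau sg)
  qed
  also have "(LINT t|lborel. (\<Sum>k. f k t)) = xi_transform (s - 6)"
    unfolding xi_transform_def by (intro Bochner_Integration.integral_cong refl sums_unique[symmetric] lim)
  finally have S: "(\<lambda>k. integral\<^sup>L lborel (f k)) sums xi_transform (s - 6)" .
  have fk: "integral\<^sup>L lborel (f k) = of_int (ramanujan_tau (Suc k)) * (of_real (c k) powr (- s) * Gamma s)" for k
    unfolding f_def E(2)[symmetric] by (rule integral_mult_right_zero)
  have "complex_of_real (c k) = of_real (2 * pi) * of_nat (Suc k)" for k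
    by (simp only: c_def of_real_mult of_real_of_nat_eq)
  hence cps: "of_real (c k) powr (- s) = of_real (2 * pi) powr (- s) * of_nat (Suc k) powr (- s)" for k
    by (simp only:) (rule powr_times_real, auto)
  have "s \<notin> \<int>\<^sub>\<le>\<^sub>0" using s by (auto elim!: nonpos_Ints_cases)
  hence G: "rGamma s * Gamma s = 1" by (simp add: Gamma_def rGamma_eq_zero_iff)
  have P: "complex_of_real (2 * pi) powr s * of_real (2 * pi) powr (- s) = 1"
    by (simp add: powr_def flip: exp_add)
  have "of_real (2 * pi) powr s * rGamma s * integral\<^sup>L lborel (f k)
     = of_int (ramanujan_tau (Suc k)) * of_nat (Suc k) powr (- s)" for k
  proof -
    have "of_real (2 * pi) powr s * rGamma s * integral\<^sup>L lborel (f k)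
       = (of_real (2 * pi) powr s * of_real (2 * pi) powr (- s)) * (rGamma s * Gamma s) * (of_int (ramanujan_tau (Suc k)) * of_nat (Suc k) powr (- s))"
      unfolding fk cps by (simp only: mult_ac)
    thus ?thesis unfolding G P by simp
  qed
  with sums_mult[OF S, of "of_real (2 * pi) powr s * rGamma s"] show ?thesis by simp
qed

text \<open>The description operator needs existence, given by the entire function on the right, and
  uniqueness, given by the identity theorem from the half-plane of convergence.\<close>

lemma ramanujan_zeta_eq:
  "ramanujan_zeta = (\<lambda>s. of_real (2 * pi) powr s * rGamma s * xi_transform (s - 6))"
  unfolding ramanujan_zeta_def
proof (rule the_equality, intro conjI allI impI)
  have "(xi_transform \<circ> (\<lambda>s. s - 6)) holomorphic_on UNIV"
    by (rule holomorphic_on_compose_gen[OF _ holomorphic_xi_transform[of UNIV]]) (auto intro!: holomorphic_intros)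
  thus holo: "(\<lambda>s. of_real (2 * pi) powr s * rGamma s * xi_transform (s - 6)) holomorphic_on UNIV"
    by (intro holomorphic_intros) (auto simp: o_def)
  fix H :: "complex \<Rightarrow> complex"
  assume H: "H holomorphic_on UNIV \<and> (\<forall>x. 13 / 2 < Re x \<longrightarrow>
      (\<lambda>k. of_int (ramanujan_tau (Suc k)) * of_nat (Suc k) powr - x) sums H x)"
  show "H = (\<lambda>s. of_real (2 * pi) powr s * rGamma s * xi_transform (s - 6))"
  proof
    fix s
    show "H s = of_real (2 * pi) powr s * rGamma s * xi_transform (s - 6)"
    proof (rule analytic_continuation_open[of "{x. Re x > 13 / 2}" UNIV H])
      show "open {x. Re x > 13 / 2}" by (rule open_halfspace_Re_gt)
      show "{x. Re x > 13 / 2} \<noteq> {}" by (auto intro: exI[of _ "of_real 7"])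
      fix x assume "x \<in> {x. Re x > 13 / 2}"
      thus "H x = of_real (2 * pi) powr x * rGamma x * xi_transform (x - 6)"
        using H ramanujan_dirichlet_series_sums[of x] sums_unique2 by blast
    qed (use H holo in auto)
  qed
qed (rule ramanujan_dirichlet_series_sums)

text \<open>Away from the poles \<open>Gamma\<close> and \<open>rGamma\<close> cancel, leaving
  \<open>xi_transform\<close>; its continuity supplies the limits that \<open>remove_sings\<close>
  takes at the poles.\<close>

lemma ramanujan_de_bruijn_eq: "ramanujan_de_bruijn = xi_transform"
proof
  fix z
  have "ramanujan_rankin_xi s = xi_transform (s - 6)" for s
    unfolding ramanujan_rankin_xi_def
  proof (rule remove_sings_eqI)
    \<comment> \<open>The poles other than \<open>s\<close> form a closed set, so some punctured
      neighbourhood of \<open>s\<close> contains none.\<close>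
    have "closed (\<int>\<^sub>\<le>\<^sub>0 - {s})" by (rule closed_subset_Ints) auto
    hence "open (- (\<int>\<^sub>\<le>\<^sub>0 - {s}))" by (rule open_Compl)
    hence "eventually (\<lambda>w. w \<in> - (\<int>\<^sub>\<le>\<^sub>0 - {s})) (nhds s)" by (rule eventually_nhds_in_open) auto
    hence ev: "eventually (\<lambda>w. w \<notin> \<int>\<^sub>\<le>\<^sub>0) (at s)" by (auto simp: eventually_at_filter elim: eventually_mono)
    have "continuous (at (s - 6)) xi_transform"
      using holomorphic_on_imp_continuous_on[OF holomorphic_xi_transform[of UNIV]]
      by (simp add: continuous_on_eq_continuous_at)
    hence "isCont (\<lambda>w. xi_transform (w - 6)) s" using isCont_o2[where f = "\<lambda>w. w - 6" and g = xi_transform and a = s] by simp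
    hence "((\<lambda>w. xi_transform (w - 6)) \<longlongrightarrow> xi_transform (s - 6)) (at s)" by (rule isContD)
    thus "((\<lambda>x. of_real (2 * pi) powr (- x) * Gamma x * ramanujan_zeta x) \<longlongrightarrow> xi_transform (s - 6)) (at s)"
    proof (rule Lim_transform_eventually)
      show "eventually (\<lambda>x. xi_transform (x - 6) = of_real (2 * pi) powr (- x) * Gamma x * ramanujan_zeta x) (at s)"
        using ev
      proof eventually_elim
        case (elim x)
        have G: "Gamma x * rGamma x = 1" using elim by (simp add: Gamma_def rGamma_eq_zero_iff)
        have P: "complex_of_real (2 * pi) powr (- x) * of_real (2 * pi) powr x = 1"
          by (simp add: powr_def flip: exp_add)
        have "of_real (2 * pi) powr (- x) * Gamma x * ramanujan_zeta x =
           (complex_of_real (2 * pi) powr (- x) * of_real (2 * pi) powr x) * (Gamma x * rGamma x) * xi_transform (x - 6)"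
          unfolding ramanujan_zeta_eq by (simp only: mult_ac)
        thus ?case unfolding G P by simp
      qed
    qed
  qed
  thus "ramanujan_de_bruijn z = xi_transform z" by (simp add: ramanujan_de_bruijn_def)
qed

section \<open>Order of growth\<close>

text \<open>By positivity of the kernel the integral over \<open>[2, 3]\<close> is a lower bound,
  with \<open>m\<close> the minimum of the kernel there. The left end 2 exceeds 1, so
  \<open>exp (2 * r)\<close> can absorb \<open>m\<close> for large \<open>r\<close> and still leave
  \<open>exp r\<close>.\<close>

lemma xi_transform_lower_bound:
  obtains m where "m > 0" "\<And>r. r \<ge> 0 \<Longrightarrow> m * exp (2 * r) \<le> norm (xi_transform (of_real r))"
proof -
  obtain t0 where t0: "t0 \<in> {2..3}" "\<And>t. t \<in> {2..3} \<Longrightarrow> xi_kernel t0 \<le> xi_kernel t"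
    using continuous_attains_inf[OF compact_Icc _ continuous_xi_kernel, of 2 3] by auto
  show ?thesis
  proof (rule that[of "xi_kernel t0"])
    fix r :: real assume r: "r \<ge> 0"
    have int: "integrable lborel (\<lambda>t. xi_kernel t * exp (r * t))"
    proof (rule Bochner_Integration.integrable_bound[OF integrable_xi_kernel_exp_abs[of r]])
      have "xi_kernel t * exp (r * t) \<le> xi_kernel t * exp (r * \<bar>t\<bar>)" for t
        using xi_kernel_pos[of t] r by (intro mult_left_mono) (auto intro: mult_left_mono)
      thus "AE t in lborel. norm (xi_kernel t * exp (r * t)) \<le> norm (xi_kernel t * exp (r * \<bar>t\<bar>))"
        using xi_kernel_pos by (intro AE_I2) (simp add: abs_mult less_imp_le)
    qed simp
    have ic: "integrable lborel (\<lambda>t. xi_kernel t0 * exp (2 * r) * indicator {2..3::real} t)"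
      by (intro integrable_mult_right integrable_real_indicator) auto
    have "xi_kernel t0 * exp (2 * r) = (LINT t|lborel. xi_kernel t0 * exp (2 * r) * indicator {2..3::real} t)"
      by (subst integral_mult_right_zero) simp
    also have "\<dots> \<le> (LINT t|lborel. xi_kernel t * exp (r * t))"
    proof (rule integral_mono[OF ic int])
      fix t
      show "xi_kernel t0 * exp (2 * r) * indicator {2..3::real} t \<le> xi_kernel t * exp (r * t)"
      proof (cases "t \<in> {2..3}")
        case True
        have "2 * r \<le> r * t" using True r by (simp add: mult.commute mult_left_mono)
        thus ?thesis using True t0(2)[OF True] xi_kernel_pos[of t] by (auto intro!: mult_mono)
      qed (use xi_kernel_pos[of t] in auto)
    qed
    also have "\<dots> \<le> norm (complex_of_real (LINT t|lborel. xi_kernel t * exp (r * t)))"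
      by simp
    also have "complex_of_real (LINT t|lborel. xi_kernel t * exp (r * t)) = xi_transform (of_real r)"
      unfolding xi_transform_def integral_complex_of_real[symmetric]
      by (intro Bochner_Integration.integral_cong) (simp_all add: exp_of_real flip: of_real_mult)
    finally show "xi_kernel t0 * exp (2 * r) \<le> norm (xi_transform (of_real r))" .
  qed (rule xi_kernel_pos)
qed

text \<open>For large \<open>r\<close> the circle maximum lies between \<open>exp r\<close> and
  \<open>exp (2 r ln r)\<close>, which squeezes the quotient between 1 and a function tending to 1.
  The limit therefore exists and equals the \<open>Limsup\<close>.\<close>

lemma growth_order_xi_transform: "growth_order xi_transform = 1"
proof -
  obtain m where m: "m > 0" "\<And>r. r \<ge> 0 \<Longrightarrow> m * exp (2 * r) \<le> norm (xi_transform (of_real r))"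
    using xi_transform_lower_bound by blast
  define K where "K = (LINT t|lborel. xi_kernel t * exp (exp \<bar>t\<bar>))"
  define M where "M r = (SUP z\<in>sphere 0 r. norm (xi_transform z))" for r
  have upper: "norm (xi_transform z) \<le> exp (r * ln r) * K" if "norm z = r" "r > 0" for z r
    using norm_xi_transform_le[of z] integral_xi_kernel_exp_abs_le[OF that(2)] that(1) by (simp add: K_def)
  have mem: "of_real r \<in> sphere (0 :: complex) r" if "r > 0" for r using that by simp
  have M_le: "M r \<le> exp (r * ln r) * K" if r: "r > 0" for r
    unfolding M_def by (rule cSUP_least) (use mem[OF r] upper r in auto)
  have M_ge: "m * exp (2 * r) \<le> M r" if r: "r > 0" for r
  proof -
    have "m * exp (2 * r) \<le> norm (xi_transform (of_real r))" using m(2) r by simp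
    also have "\<dots> \<le> M r"
      unfolding M_def
      by (rule cSUP_upper[OF mem[OF r]]) (use upper r in \<open>auto intro!: bdd_aboveI[of _ "exp (r * ln r) * K"]\<close>)
    finally show ?thesis .
  qed
  \<comment> \<open>The second condition absorbs the lower constant \<open>m\<close>, the third the
    upper constant \<open>K\<close>; \<open>max K 1\<close> makes the logarithm legitimate whatever
    the sign of \<open>K\<close>.\<close>
  have ev: "eventually (\<lambda>r. r > 1 \<and> - ln m \<le> r \<and> ln (max K 1) \<le> r * ln r) at_top"
  proof (intro eventually_conj)
    show "eventually (\<lambda>r. ln (max K 1) \<le> r * ln r) at_top"
    proof -
      have "filterlim (\<lambda>r::real. r * ln r) at_top at_top" by real_asymp
      thus ?thesis by (simp add: filterlim_at_top)
    qed
  qed (rule eventually_gt_at_top eventually_ge_at_top)+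
  have bounds: "eventually (\<lambda>r. 1 \<le> ln (ln (M r)) / ln r \<and> ln (ln (M r)) / ln r \<le> ln (2 * (r * ln r)) / ln r) at_top"
    using ev
  proof eventually_elim
    case (elim r)
    have r: "r > 1" "r > 0" "ln r > 0" using elim by auto
    have "exp r \<le> m * exp (2 * r)"
    proof -
      have "r \<le> ln m + 2 * r" using elim by simp
      hence "exp r \<le> exp (ln m + 2 * r)" by simp
      thus ?thesis using m(1) by (simp add: exp_add)
    qed
    also have "\<dots> \<le> M r" by (rule M_ge[OF r(2)])
    finally have er: "exp r \<le> M r" .
    have M0: "M r > 0" by (rule less_le_trans[OF _ er]) simp
    have lnM: "r \<le> ln (M r)" using er M0 by (simp add: ln_ge_iff)
    have "ln r \<le> ln (ln (M r))" using lnM r by simp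
    hence 1: "1 \<le> ln (ln (M r)) / ln r" using r by simp
    have "M r \<le> exp (r * ln r) * max K 1" 
      by (rule order_trans[OF M_le[OF r(2)]]) (simp add: mult_left_mono)
    also have "\<dots> = exp (r * ln r + ln (max K 1))" by (simp add: exp_add)
    also have "\<dots> \<le> exp (2 * (r * ln r))" using elim by simp
    finally have "ln (M r) \<le> 2 * (r * ln r)" using M0 by (metis ln_exp ln_le_cancel_iff exp_gt_zero)
    hence "ln (ln (M r)) \<le> ln (2 * (r * ln r))" using lnM r by (subst ln_le_cancel_iff) auto
    thus ?case using 1 r by (simp add: divide_right_mono)
  qed
  have "((\<lambda>r. ln (ln (M r)) / ln r) \<longlongrightarrow> 1) at_top"
  proof (rule tendsto_sandwich)
    show "eventually (\<lambda>r. 1 \<le> ln (ln (M r)) / ln r) at_top"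
         "eventually (\<lambda>r. ln (ln (M r)) / ln r \<le> ln (2 * (r * ln r)) / ln r) at_top"
      using bounds by (auto elim: eventually_mono)
    show "((\<lambda>r::real. ln (2 * (r * ln r)) / ln r) \<longlongrightarrow> 1) at_top" by real_asymp
  qed auto
  hence "((\<lambda>r. ereal (ln (ln (M r)) / ln r)) \<longlongrightarrow> ereal 1) at_top" by (rule tendsto_ereal)
  hence "Limsup at_top (\<lambda>r. ereal (ln (ln (M r)) / ln r)) = ereal 1"
    by (intro lim_imp_Limsup) auto
  thus ?thesis by (simp add: growth_order_def M_def)
qed

theorem corollary2:
  shows "ramanujan_de_bruijn holomorphic_on UNIV \<and>
         (\<forall>z. ramanujan_de_bruijn (- z) = ramanujan_de_bruijn z) \<and>
         growth_order ramanujan_de_bruijn = 1"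
  unfolding ramanujan_de_bruijn_eq
  using holomorphic_xi_transform xi_transform_even growth_order_xi_transform by blast

end
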